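(* Let $f\in\mathbb{Z}[X]$ be a polynomial in one variable with integral coefficients. The following conditions are equivalent. (1) $f$ defines generic units. (2) There is an infinite arithmetic sequence $S$ of positive integers such that $f$ defines a unit on every order in $S$. (3) There is a positive integer $D$ such that for every positive integer $n$, $f$ defines a unit on an order $m$ with $n\le m\le n+D$. (4) $f=\pm X^m\prod_{i=1}^k \Phi_{m_i}$ with $m$ and $k$ non-negative integers and $m_1,\dots,m_k$ positive integers which are neither $1$ nor prime powers.
   Context: For a group $G$, $\mathbb{Z}G$ denotes the integral group ring. For $x\in G$ and $f\in\mathbb{Z}[X]$, $f(x)\in\mathbb{Z}G$ is the element obtained by evaluating $f$ at $x$. If $x\in G$ has finite order $n$, whether $f(x)$ is a unit of $\mathbb{Z}G$ depends only on $n$ (and $f$); when it is a unit, $f$ is said to define a unit on order $n$ (equivalently, the class of $f$ is a unit in $\mathbb{Z}[X]/(X^n-1)$). The polynomial $f$ defines generic units if there is a positive integer $D$ such that $f$ defines a unit on every order $n$ (positive integer) coprime with $D$. $\Phi_m$ denotes the $m$-th cyclotomic polynomial. A prime power is an integer $p^\alpha$ with $p$ prime and $\alpha\ge 1$. An infinite arithmetic sequence of positive integers is a set $\{b+jr : j\ge 0\}$ with $b,r$ positive integers. *)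

theory Defs
  imports
    "HOL-Algebra.Multiplicative_Group"
    "HOL-Algebra.Free_Abelian_Groups"
    "HOL-Library.Poly_Mapping"
    "HOL-Computational_Algebra.Computational_Algebra"
    "HOL-Number_Theory.Prime_Powers"
begin

text \<open>
  \<open>int_group_ring G\<close> is \<open>\<int>G\<close>, with underlying group the free abelian group on the carrier of \<open>G\<close>
  (as in \<^const>\<open>free_Abelian_group\<close>).
\<close>

definition int_group_ring :: "('a, 'b) monoid_scheme \<Rightarrow> ('a \<Rightarrow>\<^sub>0 int) ring" where
  "int_group_ring G =
    \<lparr>carrier = {u. Poly_Mapping.keys u \<subseteq> carrier G},
     monoid.mult = (\<lambda>u v. \<Sum>g\<in>Poly_Mapping.keys u. \<Sum>h\<in>Poly_Mapping.keys v.
       Poly_Mapping.single (g \<otimes>\<^bsub>G\<^esub> h) (Poly_Mapping.lookup u g * Poly_Mapping.lookup v h)),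
     one = Poly_Mapping.single \<one>\<^bsub>G\<^esub> 1,
     ring.zero = 0,
     ring.add = (+)\<rparr>"

definition eval_group_ring :: "('a, 'b) monoid_scheme \<Rightarrow> int poly \<Rightarrow> 'a \<Rightarrow> ('a \<Rightarrow>\<^sub>0 int)" where
  "eval_group_ring G f x = (\<Sum>i\<le>degree f. Poly_Mapping.single (x [^]\<^bsub>G\<^esub> i) (coeff f i))"

text \<open>
  The canonical group \<open>\<int>/n\<int>\<close> and its generator \<open>1 mod n\<close> (which is \<open>0\<close> for \<open>n = 1\<close>) serve as the
  group and the element of order \<open>n\<close>; \<open>eval_unit_iff_defines_unit_on\<close> below shows that any element
  of order \<open>n\<close> of any group gives the same notion. Only \<open>n > 0\<close> is meaningful.
\<close>

definition defines_unit_on :: "int poly \<Rightarrow> nat \<Rightarrow> bool" where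
  "defines_unit_on f n \<longleftrightarrow>
     eval_group_ring (integer_mod_group n) f (1 mod int n) \<in> Units (int_group_ring (integer_mod_group n))"

definition defines_generic_units :: "int poly \<Rightarrow> bool" where
  "defines_generic_units f \<longleftrightarrow> (\<exists>D::nat. D > 0 \<and> (\<forall>n>0. coprime n D \<longrightarrow> defines_unit_on f n))"

definition primitive_roots_of_unity :: "nat \<Rightarrow> complex set" where
  "primitive_roots_of_unity n = {z. z ^ n = 1 \<and> (\<forall>k. 0 < k \<and> k < n \<longrightarrow> z ^ k \<noteq> 1)}"

text \<open>For \<open>n > 0\<close> the polynomial described here exists; see \<open>map_poly_cyclotomic\<close> below.\<close>

definition cyclotomic :: "nat \<Rightarrow> int poly" where
  "cyclotomic n = (THE p. map_poly of_int p = (\<Prod>z\<in>primitive_roots_of_unity n. [:- z, 1:]))"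


subsection \<open>The group ring is a ring\<close>

lemma group_ring_mult_eq_frag:
  "u \<otimes>\<^bsub>int_group_ring G\<^esub> v = frag_extend (\<lambda>g. frag_extend (\<lambda>h. frag_of (g \<otimes>\<^bsub>G\<^esub> h)) v) u"
proof -
  have *: "frag_cmul c (frag_of a) = Poly_Mapping.single a c" for c :: int and a :: 'a
    by (rule poly_mapping_eqI) (simp add: lookup_single when_def)
  have **: "frag_cmul d (Poly_Mapping.single a c) = Poly_Mapping.single a (d * c)" for c d :: int and a :: 'a
    by (rule poly_mapping_eqI) (simp add: lookup_single when_def)
  show ?thesis
    unfolding int_group_ring_def frag_extend_def
    by (simp add: frag_cmul_sum * **)
qed

lemma ring_int_group_ring:
  fixes G (structure)
  assumes "group G"
  shows "ring (int_group_ring G)"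
proof -
  interpret group G by fact
  let ?R = "int_group_ring G"
  have C: "carrier ?R = {u. Poly_Mapping.keys u \<subseteq> carrier G}"
    and A: "\<And>u v. u \<oplus>\<^bsub>?R\<^esub> v = u + v" and Z: "\<zero>\<^bsub>?R\<^esub> = 0" and O: "\<one>\<^bsub>?R\<^esub> = frag_of \<one>"
    by (simp_all add: int_group_ring_def)
  have addL: "(u + v) \<otimes>\<^bsub>?R\<^esub> w = u \<otimes>\<^bsub>?R\<^esub> w + v \<otimes>\<^bsub>?R\<^esub> w" for u v w
    by (simp add: group_ring_mult_eq_frag frag_extend_add)
  have diffL: "(u - v) \<otimes>\<^bsub>?R\<^esub> w = u \<otimes>\<^bsub>?R\<^esub> w - v \<otimes>\<^bsub>?R\<^esub> w" for u v w
    by (simp add: group_ring_mult_eq_frag frag_extend_diff)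
  have fe_add: "frag_extend (\<lambda>g. F g + H g) u = frag_extend F u + frag_extend H u"
    for F H :: "'a \<Rightarrow> 'a \<Rightarrow>\<^sub>0 int" and u
    by (simp add: frag_extend_def frag_cmul_distrib2 sum.distrib)
  have fe_diff: "frag_extend (\<lambda>g. F g - H g) u = frag_extend F u - frag_extend H u"
    for F H :: "'a \<Rightarrow> 'a \<Rightarrow>\<^sub>0 int" and u
    using fe_add[of "\<lambda>g. F g - H g" H u] by (simp add: algebra_simps)
  have addR: "w \<otimes>\<^bsub>?R\<^esub> (u + v) = w \<otimes>\<^bsub>?R\<^esub> u + w \<otimes>\<^bsub>?R\<^esub> v" for u v w
    by (simp add: group_ring_mult_eq_frag frag_extend_add fe_add)
  have diffR: "w \<otimes>\<^bsub>?R\<^esub> (u - v) = w \<otimes>\<^bsub>?R\<^esub> u - w \<otimes>\<^bsub>?R\<^esub> v" for u v w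
    by (simp add: group_ring_mult_eq_frag frag_extend_diff fe_diff)
  have zL: "0 \<otimes>\<^bsub>?R\<^esub> w = 0" and zR: "w \<otimes>\<^bsub>?R\<^esub> 0 = 0" for w
    using diffL[of w w w] diffR[of w w w] by simp_all
  have ofof: "frag_of g \<otimes>\<^bsub>?R\<^esub> frag_of h = frag_of (g \<otimes> h)" for g h
    by (simp add: group_ring_mult_eq_frag)
  have closed: "Poly_Mapping.keys (u \<otimes>\<^bsub>?R\<^esub> v) \<subseteq> carrier G"
    if "Poly_Mapping.keys u \<subseteq> carrier G" "Poly_Mapping.keys v \<subseteq> carrier G" for u v
  proof -
    have "Poly_Mapping.keys (frag_extend (\<lambda>h. frag_of (g \<otimes> h)) v) \<subseteq> carrier G"
      if "g \<in> carrier G" for g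
      using keys_frag_extend[of "\<lambda>h. frag_of (g \<otimes> h)" v] \<open>Poly_Mapping.keys v \<subseteq> _\<close> that
      by fastforce
    then have "(\<Union>g\<in>Poly_Mapping.keys u.
        Poly_Mapping.keys (frag_extend (\<lambda>h. frag_of (g \<otimes> h)) v)) \<subseteq> carrier G"
      using that(1) by blast
    then show ?thesis
      using keys_frag_extend[of "\<lambda>g. frag_extend (\<lambda>h. frag_of (g \<otimes> h)) v" u]
      unfolding group_ring_mult_eq_frag by (rule order_trans[rotated])
  qed
  have assoc: "u \<otimes>\<^bsub>?R\<^esub> v \<otimes>\<^bsub>?R\<^esub> w = u \<otimes>\<^bsub>?R\<^esub> (v \<otimes>\<^bsub>?R\<^esub> w)"
    if u: "Poly_Mapping.keys u \<subseteq> carrier G" and v: "Poly_Mapping.keys v \<subseteq> carrier G"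
      and w: "Poly_Mapping.keys w \<subseteq> carrier G" for u v w
    using u
  proof (induction rule: frag_induction)
    case zero show ?case by (simp add: zL)
  next
    case (diff a b) then show ?case by (simp add: diffL)
  next
    case (one a)
    show ?case using v
    proof (induction rule: frag_induction)
      case zero show ?case by (simp add: zL zR)
    next
      case (diff a b) then show ?case by (simp add: diffL diffR)
    next
      case (one b)
      show ?case using w
      proof (induction rule: frag_induction)
        case zero show ?case by (simp add: zR)
      next
        case (diff a b) then show ?case by (simp add: diffR)
      next
        case (one c)
        then show ?case using \<open>a \<in> _\<close> \<open>b \<in> _\<close> by (simp add: ofof m_assoc)
      qed
    qed
  qed
  have oneL: "frag_of \<one> \<otimes>\<^bsub>?R\<^esub> u = u" and oneR: "u \<otimes>\<^bsub>?R\<^esub> frag_of \<one> = u"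
    if "Poly_Mapping.keys u \<subseteq> carrier G" for u
    using that
    by (induction rule: frag_induction; simp add: zL zR diffL diffR ofof)+
  show ?thesis
  proof (rule ringI)
    show "abelian_group ?R"
    proof (rule abelian_groupI)
      fix x assume "x \<in> carrier ?R"
      then show "\<exists>y\<in>carrier ?R. y \<oplus>\<^bsub>?R\<^esub> x = \<zero>\<^bsub>?R\<^esub>"
        by (intro bexI[of _ "- x"]) (auto simp: C A Z)
    next
      fix x y assume "x \<in> carrier ?R" "y \<in> carrier ?R"
      then show "x \<oplus>\<^bsub>?R\<^esub> y \<in> carrier ?R"
        using Poly_Mapping.keys_add[of x y] by (auto simp: C A)
    qed (auto simp: C A Z add_ac)
    show "monoid ?R"
      by (rule monoidI) (auto simp: C O oneL oneR assoc dest: closed[THEN subsetD])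
  qed (auto simp: A addL addR)
qed


subsection \<open>The order of the element determines whether the value is a unit\<close>

lemma monic_division:
  fixes f g :: "int poly"
  assumes "lead_coeff g = 1"
  obtains q r where "f = g * q + r" "r = 0 \<or> degree r < degree g"
proof -
  obtain q r where qr: "pseudo_divmod f g = (q, r)" by (cases "pseudo_divmod f g")
  have "g \<noteq> 0" using assms by auto
  show ?thesis
    using that pseudo_divmod(1)[OF \<open>g \<noteq> 0\<close> qr] pseudo_divmod(2)[OF \<open>g \<noteq> 0\<close> qr] assms by auto
qed

context
  fixes G (structure) and x n
  assumes G: "group G" and x: "x \<in> carrier G" and n: "group.ord G x = n" "n > 0"
begin

interpretation group G by (fact G)

private abbreviation "ev f \<equiv> eval_group_ring G f x"
private abbreviation "R \<equiv> int_group_ring G"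

private lemma ring_R: "ring R" by (rule ring_int_group_ring) (fact G)

private lemma ev_eq: "degree f \<le> N \<Longrightarrow> ev f = (\<Sum>i\<le>N. Poly_Mapping.single (x [^] i) (coeff f i))"
  unfolding eval_group_ring_def
  by (rule sum.mono_neutral_left) (auto simp: coeff_eq_0)

private lemma ev_add: "ev (f + g) = ev f + ev g"
proof -
  define N where "N = max (degree f) (degree g)"
  have "degree f \<le> N" "degree g \<le> N" "degree (f + g) \<le> N"
    by (auto simp: N_def degree_add_le)
  then show ?thesis by (simp add: ev_eq sum.distrib single_add)
qed

private lemma ev_0: "ev 0 = 0" by (simp add: eval_group_ring_def)

private lemma ev_uminus: "ev (- f) = - ev f"
  using ev_add[of f "- f"] ev_0 by (simp add: add_eq_0_iff)

private lemma ev_diff: "ev (f - g) = ev f - ev g"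
  using ev_add[of f "- g"] by (simp add: ev_uminus)

private lemma ev_monom: "ev (monom c k) = Poly_Mapping.single (x [^] k) c"
proof -
  have "ev (monom c k) = (\<Sum>i\<le>k. Poly_Mapping.single (x [^] i) (coeff (monom c k) i))"
    by (rule ev_eq) (rule degree_monom_le)
  also have "\<dots> = (\<Sum>i\<in>{k}. Poly_Mapping.single (x [^] i) (coeff (monom c k) i))"
    by (rule sum.mono_neutral_right) auto
  finally show ?thesis by simp
qed

private lemma ev_1: "ev 1 = \<one>\<^bsub>R\<^esub>"
  using ev_monom[of 1 0] by (simp add: int_group_ring_def monom_0 flip: one_pCons)

private lemma ev_in: "ev f \<in> carrier R"
  unfolding int_group_ring_def eval_group_ring_def
  using x by (auto dest!: keys_sum[THEN subsetD] split: if_splits)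

private lemma R_add: "u \<oplus>\<^bsub>R\<^esub> v = u + v" by (simp add: int_group_ring_def)

private lemma single_mult:
  "Poly_Mapping.single a c \<otimes>\<^bsub>R\<^esub> Poly_Mapping.single b d = Poly_Mapping.single (a \<otimes> b) (c * d)"
  by (cases "c = 0"; cases "d = 0") (auto simp: int_group_ring_def)

private lemma ev_monom_mult_sum:
  "ev (monom c k * (\<Sum>i\<in>I. monom (b i) i)) = ev (monom c k) \<otimes>\<^bsub>R\<^esub> ev (\<Sum>i\<in>I. monom (b i) i)"
  if "finite I" for I :: "nat set"
  using that
proof (induction I)
  case empty
  show ?case using ring.ring_simprules(25)[OF ring_R ev_in, of "monom c k"] 
    by (simp add: ev_0 int_group_ring_def)
next
  case (insert i I)
  have "ev (monom c k * (\<Sum>i\<in>insert i I. monom (b i) i))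
      = ev (monom c k * monom (b i) i) + ev (monom c k * (\<Sum>i\<in>I. monom (b i) i))"
    using insert by (simp add: distrib_left ev_add)
  also have "ev (monom c k * monom (b i) i) = ev (monom c k) \<otimes>\<^bsub>R\<^esub> ev (monom (b i) i)"
    using x by (simp add: mult_monom ev_monom single_mult nat_pow_mult)
  finally show ?case
    using insert ring.ring_simprules(23)[OF ring_R ev_in ev_in ev_in]
    by (simp add: ev_add R_add)
qed

private lemma ev_sum_mult:
  "ev ((\<Sum>i\<in>I. monom (b i) i) * g) = ev (\<Sum>i\<in>I. monom (b i) i) \<otimes>\<^bsub>R\<^esub> ev g"
  if "finite I" for I :: "nat set"
  using that
proof (induction I)
  case empty
  show ?case by (simp add: ev_0 int_group_ring_def)
next
  case (insert i I)
  have "ev ((\<Sum>i\<in>insert i I. monom (b i) i) * g)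
      = ev (monom (b i) i * g) + ev ((\<Sum>i\<in>I. monom (b i) i) * g)"
    using insert by (simp add: distrib_right ev_add)
  also have "ev (monom (b i) i * g) = ev (monom (b i) i) \<otimes>\<^bsub>R\<^esub> ev g"
    using ev_monom_mult_sum[of "{..degree g}" "b i" i "coeff g"]
    by (simp add: poly_as_sum_of_monoms)
  finally show ?case
    using insert ring.ring_simprules(13)[OF ring_R ev_in ev_in ev_in]
    by (simp add: ev_add R_add)
qed

private lemma ev_mult: "ev (f * g) = ev f \<otimes>\<^bsub>R\<^esub> ev g"
  using ev_sum_mult[of "{..degree f}" "coeff f" g] by (simp add: poly_as_sum_of_monoms)

private lemma inj_pow: "i < n \<Longrightarrow> j < n \<Longrightarrow> x [^] i = x [^] j \<Longrightarrow> i = j"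
  using ord_inj[OF x] n by (auto simp: inj_on_def)

private lemma ev_cyc: "ev (monom 1 n - 1) = 0"
  using pow_ord_eq_1[OF x] ev_monom[of 1 0] by (simp add: ev_diff ev_monom n monom_0 flip: one_pCons)

private lemma ev_eq_0_iff: "ev p = 0 \<longleftrightarrow> (monom 1 n - 1) dvd p"
proof
  assume "(monom 1 n - 1) dvd p"
  then obtain q where "p = (monom 1 n - 1) * q" by blast
  then show "ev p = 0" 
    using ev_mult[of "monom 1 n - 1" q] ev_cyc by (simp add: int_group_ring_def)
next
  assume p0: "ev p = 0"
  let ?g = "monom 1 n - 1 :: int poly"
  have dg: "degree ?g = n"
    using n(2) degree_add_eq_left[of "-1" "monom 1 n :: int poly"] by (simp add: degree_monom_eq)
  have "lead_coeff ?g = 1"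
    using n(2) unfolding dg by simp
  then obtain q r where qr: "p = ?g * q + r" "r = 0 \<or> degree r < degree ?g"
    by (rule monic_division)
  have "r = 0"
  proof (rule ccontr)
    assume "r \<noteq> 0"
    then have dr: "degree r < n" using qr dg by auto
    have "ev (?g * q) = 0" using ev_cyc by (simp add: ev_mult int_group_ring_def)
    then have r0: "ev r = 0" using p0 qr(1) ev_add[of "?g * q" r] by simp
    have "Poly_Mapping.lookup (ev r) (x [^] degree r) =
        (\<Sum>i\<le>degree r. if i = degree r then coeff r i else 0)"
      unfolding eval_group_ring_def lookup_sum using inj_pow dr
      by (intro sum.cong) (auto simp: lookup_single when_def)
    also have "\<dots> = lead_coeff r" by simp
    finally show False using r0 \<open>r \<noteq> 0\<close> by simp
  qed
  then show "?g dvd p" using qr by simp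
qed

text \<open>\<open>f(x)\<close> is a unit of \<open>\<int>G\<close> iff the class of \<open>f\<close> is a unit of \<open>\<int>[X]/(X\<^sup>n - 1)\<close>.\<close>

lemma eval_unit_iff_poly:
  "eval_group_ring G f x \<in> Units (int_group_ring G) \<longleftrightarrow> (\<exists>g. (monom 1 n - 1) dvd (f * g - 1))"
proof
  assume "\<exists>g. (monom 1 n - 1) dvd (f * g - 1)"
  then obtain g where "(monom 1 n - 1) dvd (f * g - 1)" ..
  then have "ev (f * g) = ev 1"
    using ev_eq_0_iff[of "f * g - 1"] by (simp add: ev_diff)
  then show "ev f \<in> Units R"
    using ev_in ev_mult[of f g] ev_mult[of g f]
    by (auto simp: Units_def ev_1 mult.commute[of g] intro!: bexI[of _ "ev g"])
next
  assume "ev f \<in> Units R"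
  then obtain u where u: "u \<in> carrier R" "ev f \<otimes>\<^bsub>R\<^esub> u = \<one>\<^bsub>R\<^esub>"
    by (auto simp: Units_def)
  define H where "H = range (\<lambda>i::nat. x [^] i)"
  have Hc: "H \<subseteq> carrier G" using x by (auto simp: H_def)
  define u1 where "u1 = (\<Sum>h\<in>Poly_Mapping.keys u \<inter> H. Poly_Mapping.single h (Poly_Mapping.lookup u h))"
  define u2 where "u2 = u - u1"
  have lu1: "Poly_Mapping.lookup u1 h = (if h \<in> H then Poly_Mapping.lookup u h else 0)" for h
  proof -
    have "Poly_Mapping.lookup u1 h =
        (\<Sum>k\<in>Poly_Mapping.keys u \<inter> H. if k = h then Poly_Mapping.lookup u h else 0)"
      unfolding u1_def lookup_sum by (intro sum.cong) (auto simp: lookup_single when_def)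
    then show ?thesis by (auto simp: in_keys_iff)
  qed
  have u1c: "u1 \<in> carrier R" and u2c: "u2 \<in> carrier R"
    using u(1) Hc by (auto simp: int_group_ring_def u2_def in_keys_iff lu1 lookup_minus split: if_splits)
  have ku1: "Poly_Mapping.keys u1 \<subseteq> H" by (auto simp: in_keys_iff lu1 split: if_splits)
  have ku2: "Poly_Mapping.keys u2 \<subseteq> carrier G - H"
    using u2c by (auto simp: int_group_ring_def in_keys_iff lu1 u2_def lookup_minus split: if_splits)
  have k_ev: "Poly_Mapping.keys (ev f) \<subseteq> H"
    unfolding eval_group_ring_def H_def by (auto dest!: keys_sum[THEN subsetD] split: if_splits)
  have keys_mult: "Poly_Mapping.keys (ev f \<otimes>\<^bsub>R\<^esub> v) \<subseteq> {g \<otimes> h | g h. g \<in> H \<and> h \<in> Poly_Mapping.keys v}" for v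
    using k_ev unfolding int_group_ring_def
    by (fastforce dest!: keys_sum[THEN subsetD] split: if_splits)
  have k1: "Poly_Mapping.keys (ev f \<otimes>\<^bsub>R\<^esub> u1) \<subseteq> H"
  proof -
    have "{g \<otimes> h | g h. g \<in> H \<and> h \<in> Poly_Mapping.keys u1} \<subseteq> H"
      using ku1 x by (auto simp: H_def nat_pow_mult subset_iff)
    then show ?thesis using keys_mult[of u1] by blast
  qed
  have k2: "Poly_Mapping.keys (ev f \<otimes>\<^bsub>R\<^esub> u2) \<inter> H = {}"
  proof -
    have "h \<in> H" if "x [^] (i::nat) \<otimes> h = x [^] (j::nat)" "h \<in> carrier G" for i j h
    proof -
      define l where "l = i * n - i"
      have "l + i = i * n" using n(2) by (simp add: l_def)
      then have "x [^] l \<otimes> x [^] i = \<one>"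
        using pow_eq_id[OF x, of "i * n"] x n by (simp add: nat_pow_mult)
      then have "h = x [^] l \<otimes> (x [^] i \<otimes> h)"
        using x that(2) by (simp flip: m_assoc)
      also have "\<dots> = x [^] (l + j)" using that x by (simp add: nat_pow_mult)
      finally show ?thesis by (auto simp: H_def)
    qed
    then have *: "h \<in> H" if "g \<in> H" "g \<otimes> h \<in> H" "h \<in> carrier G" for g h
      using that unfolding H_def by blast
    show ?thesis
    proof (rule ccontr)
      assume "Poly_Mapping.keys (ev f \<otimes>\<^bsub>R\<^esub> u2) \<inter> H \<noteq> {}"
      then obtain g h where "g \<in> H" "h \<in> Poly_Mapping.keys u2" "g \<otimes> h \<in> H"
        using keys_mult[of u2] by blast
      then show False using *[of g h] ku2 by blast
    qed
  qed
  have "ev f \<otimes>\<^bsub>R\<^esub> u1 + ev f \<otimes>\<^bsub>R\<^esub> u2 = \<one>\<^bsub>R\<^esub>"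
    using ring.ring_simprules(23)[OF ring_R u1c u2c ev_in, of f] u(2)
    by (simp add: R_add u2_def)
  then have e2: "ev f \<otimes>\<^bsub>R\<^esub> u2 = \<one>\<^bsub>R\<^esub> - ev f \<otimes>\<^bsub>R\<^esub> u1" by (simp add: algebra_simps)
  have "\<one> \<in> H" unfolding H_def by (rule range_eqI[of _ _ 0]) simp
  then have "Poly_Mapping.keys (\<one>\<^bsub>R\<^esub> - ev f \<otimes>\<^bsub>R\<^esub> u1) \<subseteq> H"
    using k1 keys_diff[of "\<one>\<^bsub>R\<^esub>" "ev f \<otimes>\<^bsub>R\<^esub> u1"] by (auto simp: int_group_ring_def)
  then have "\<one>\<^bsub>R\<^esub> - ev f \<otimes>\<^bsub>R\<^esub> u1 = 0"
    using k2 e2 by (metis inf.absorb_iff1 keys_eq_empty)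
  then have e1: "ev f \<otimes>\<^bsub>R\<^esub> u1 = \<one>\<^bsub>R\<^esub>" by simp
  define g where "g = (\<Sum>i<n. monom (Poly_Mapping.lookup u (x [^] i)) i)"
  have H': "H = (\<lambda>i::nat. x [^] i) ` {..<n}"
  proof -
    have "x [^] (i::nat) \<in> (\<lambda>i::nat. x [^] i) ` {..<n}" for i
    proof -
      have "x [^] i = x [^] (i mod n) \<otimes> x [^] (n * (i div n))"
        using x by (simp add: nat_pow_mult)
      moreover have "x [^] (n * (i div n)) = \<one>"
        using pow_eq_id[OF x, of "n * (i div n)"] n by simp
      ultimately have "x [^] i = x [^] (i mod n)" using x by simp
      then show ?thesis using n(2) by auto
    qed
    then show ?thesis by (auto simp: H_def)
  qed
  have "ev g = (\<Sum>i<n. ev (monom (Poly_Mapping.lookup u (x [^] i)) i))"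
    unfolding g_def by (induction n) (simp_all add: ev_0 ev_add)
  also have "\<dots> = (\<Sum>i<n. Poly_Mapping.single (x [^] i) (Poly_Mapping.lookup u (x [^] i)))"
    by (simp add: ev_monom)
  also have "\<dots> = (\<Sum>h\<in>H. Poly_Mapping.single h (Poly_Mapping.lookup u h))"
    unfolding H' by (subst sum.reindex) (auto simp: inj_on_def intro: inj_pow)
  also have "\<dots> = u1"
    unfolding u1_def by (rule sum.mono_neutral_right) (auto simp: H' in_keys_iff)
  finally have "ev (f * g - 1) = 0" using e1 by (simp add: ev_diff ev_mult ev_1)
  then show "\<exists>g. (monom 1 n - 1) dvd (f * g - 1)" using ev_eq_0_iff by blast
qed

end

lemma defines_unit_on_iff_poly:
  assumes "n > 0"
  shows "defines_unit_on f n \<longleftrightarrow> (\<exists>g. (monom 1 n - 1) dvd (f * g - 1))"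
  unfolding defines_unit_on_def
proof (rule eval_unit_iff_poly)
  interpret group "integer_mod_group n" by simp
  show c: "1 mod int n \<in> carrier (integer_mod_group n)"
    using assms by (simp add: carrier_integer_mod_group)
  have "(1 mod int n) [^]\<^bsub>integer_mod_group n\<^esub> k = \<one>\<^bsub>integer_mod_group n\<^esub> \<longleftrightarrow> n dvd k" for k :: nat
    by (simp add: mod_mult_right_eq mod_eq_0_iff_dvd)
  then show "ord (1 mod int n) = n"
    using pow_eq_id[OF c] by (metis dvd_antisym dvd_refl)
qed (use assms in auto)

theorem eval_unit_iff_defines_unit_on:
  assumes "group G" "x \<in> carrier G" "group.ord G x = n" "n > 0"
  shows "eval_group_ring G f x \<in> Units (int_group_ring G) \<longleftrightarrow> defines_unit_on f n"
  using eval_unit_iff_poly[OF assms] defines_unit_on_iff_poly[OF assms(4)] by simp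


subsection \<open>Existence of the cyclotomic polynomials\<close>

lemma map_poly_of_int_add: "map_poly of_int (p + q :: int poly) = (map_poly of_int p + map_poly of_int q :: complex poly)"
  by (rule poly_eqI) (simp add: coeff_map_poly)

lemma map_poly_of_int_mult: "map_poly of_int (p * q :: int poly) = (map_poly of_int p * map_poly of_int q :: complex poly)"
  by (rule poly_eqI) (simp add: coeff_map_poly coeff_mult)

lemma map_poly_of_int_prod:
  "map_poly of_int (\<Prod>i\<in>I. P i :: int poly) = (\<Prod>i\<in>I. map_poly of_int (P i) :: complex poly)"
  by (induction I rule: infinite_finite_induct) (simp_all add: map_poly_of_int_mult)

lemma map_poly_of_int_inj:
  "map_poly of_int p = (map_poly of_int q :: complex poly) \<Longrightarrow> p = (q :: int poly)"
  by (rule poly_eqI) (metis coeff_map_poly of_int_0 of_int_eq_iff)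

lemma finite_primitive_roots: "n > 0 \<Longrightarrow> finite (primitive_roots_of_unity n)"
  by (rule finite_subset[OF _ finite_roots_unity[of n]]) (auto simp: primitive_roots_of_unity_def)

lemma roots_of_unity_eq_UN:
  assumes "n > 0"
  shows "{z::complex. z ^ n = 1} = (\<Union>d\<in>{d. d dvd n}. primitive_roots_of_unity d)"
proof (intro equalityI subsetI)
  fix z :: complex assume z: "z \<in> {z. z ^ n = 1}"
  define d where "d = (LEAST d. d > 0 \<and> z ^ d = 1)"
  have d: "d > 0 \<and> z ^ d = 1"
    unfolding d_def by (rule LeastI[of _ n]) (use z assms in auto)
  have dmin: "z ^ k \<noteq> 1" if "0 < k" "k < d" for k
    using not_less_Least[of k "\<lambda>d. d > 0 \<and> z ^ d = 1"] that by (auto simp: d_def)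
  have "z ^ n = z ^ (d * (n div d)) * z ^ (n mod d)" by (simp flip: power_add)
  then have "z ^ (n mod d) = 1" using z d by (simp add: power_mult)
  then have "d dvd n" using dmin[of "n mod d"] d by (metis dvd_eq_mod_eq_0 mod_less_divisor neq0_conv)
  then show "z \<in> (\<Union>d\<in>{d. d dvd n}. primitive_roots_of_unity d)"
    using d dmin by (auto simp: primitive_roots_of_unity_def)
qed (auto simp: primitive_roots_of_unity_def power_mult elim!: dvdE)

lemma monom_diff_1_eq_prod:
  assumes "n > 0"
  shows "(monom 1 n - 1 :: complex poly) = (\<Prod>z | z ^ n = 1. [:- z, 1:])"
proof (rule poly_eqI_degree_lead_coeff[where A = "{z. z ^ n = 1}" and n = n])
  have fin: "finite {z::complex. z ^ n = 1}" using assms by (intro finite_roots_unity) auto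
  have dg: "degree (\<Prod>z::complex | z ^ n = 1. [:- z, 1:]) = n"
    using card_roots_unity_eq[OF assms] by (subst degree_prod_eq_sum_degree) auto
  show "degree (\<Prod>z::complex | z ^ n = 1. [:- z, 1:]) \<le> n" using dg by simp
  have "lead_coeff (\<Prod>z::complex | z ^ n = 1. [:- z, 1:]) = 1" by (simp add: lead_coeff_prod)
  then show "coeff (monom 1 n - 1) n = coeff (\<Prod>z::complex | z ^ n = 1. [:- z, 1:]) n"
    using assms unfolding dg by simp
  show "degree (monom 1 n - 1 :: complex poly) \<le> n"
    by (intro degree_diff_le degree_monom_le) simp
  show "poly (monom 1 n - 1) z = poly (\<Prod>z::complex | z ^ n = 1. [:- z, 1:]) z"
    if "z \<in> {z. z ^ n = 1}" for z :: complex
    using that fin by (auto simp: poly_monom poly_prod)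
qed (use card_roots_unity_eq[OF assms] in simp)

lemma monom_diff_1_eq_prod_primitive:
  assumes "n > 0"
  shows "(monom 1 n - 1 :: complex poly)
    = (\<Prod>d | d dvd n. \<Prod>z\<in>primitive_roots_of_unity d. [:- z, 1:])"
proof -
  have disj: "primitive_roots_of_unity d \<inter> primitive_roots_of_unity e = {}"
    if "d \<noteq> e" "d dvd n" "e dvd n" for d e
  proof -
    have "d > 0" "e > 0" using that assms by (auto intro!: Nat.gr0I)
    then show ?thesis
      using \<open>d \<noteq> e\<close> by (auto simp: primitive_roots_of_unity_def) (metis nat_neq_iff)
  qed
  have "(\<Prod>d | d dvd n. \<Prod>z\<in>primitive_roots_of_unity d. [:- z, 1:])
      = (\<Prod>z\<in>(\<Union>d\<in>{d. d dvd n}. primitive_roots_of_unity d). [:- z, 1:])"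
    using assms disj
    by (intro prod.UNION_disjoint[symmetric]) (auto intro!: finite_primitive_roots Nat.gr0I)
  then show ?thesis using monom_diff_1_eq_prod[OF assms] roots_of_unity_eq_UN[OF assms] by simp
qed

lemma ex_cyclotomic:
  "n > 0 \<Longrightarrow> \<exists>p::int poly. map_poly of_int p = (\<Prod>z\<in>primitive_roots_of_unity n. [:- z, 1:])"
proof (induction n rule: less_induct)
  case (less n)
  define C where "C d = (\<Prod>z\<in>primitive_roots_of_unity d. [:- z, 1:])" for d
  let ?D = "{d. d dvd n \<and> d \<noteq> n}"
  have "\<exists>p::int poly. map_poly of_int p = C d" if "d \<in> ?D" for d
    using less that by (auto simp: C_def intro!: less.IH Nat.gr0I dest: dvd_imp_le)
  then obtain P :: "nat \<Rightarrow> int poly" where P: "\<And>d. d \<in> ?D \<Longrightarrow> map_poly of_int (P d) = C d"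
    by metis
  define Q where "Q = (\<Prod>d\<in>?D. P d)"
  have mQ: "map_poly of_int Q = (\<Prod>d\<in>?D. C d)" by (simp add: Q_def map_poly_of_int_prod P)
  have fin: "finite ?D" using less.prems by simp
  have "{d. d dvd n} = insert n ?D" by auto
  then have XC: "(monom 1 n - 1 :: complex poly) = C n * map_poly of_int Q"
    using monom_diff_1_eq_prod_primitive[OF less.prems] fin mQ by (simp add: C_def)
  have lQ': "lead_coeff (map_poly of_int Q :: complex poly) = 1"
    unfolding mQ C_def by (simp add: lead_coeff_prod)
  have dQ: "degree (map_poly of_int p :: complex poly) = degree p" for p :: "int poly"
    by (intro degree_map_poly) auto
  have "of_int (lead_coeff Q) = (1::complex)" using lQ' by (simp add: dQ coeff_map_poly)
  then have "lead_coeff Q = 1" by simp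
  then obtain q r where qr: "monom 1 n - 1 = Q * q + r" "r = 0 \<or> degree r < degree Q"
    by (rule monic_division)
  have "map_poly of_int (monom 1 n - 1 :: int poly) = (monom 1 n - 1 :: complex poly)"
    by (rule poly_eqI) (simp add: coeff_map_poly)
  then have "C n * map_poly of_int Q = map_poly of_int Q * map_poly of_int q + map_poly of_int r"
    using XC qr(1) by (simp add: map_poly_of_int_mult map_poly_of_int_add)
  then have R: "map_poly of_int r = (C n - map_poly of_int q) * map_poly of_int Q"
    by (simp add: algebra_simps)
  have "C n - map_poly of_int q = 0"
  proof (rule ccontr)
    assume nz: "C n - map_poly of_int q \<noteq> 0"
    have Q0: "map_poly of_int Q \<noteq> (0 :: complex poly)" using lQ' by auto
    then have "degree r = degree (C n - map_poly of_int q) + degree Q"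
      using degree_mult_eq[OF nz Q0] R dQ[of r] dQ[of Q] by simp
    moreover have "r \<noteq> 0" using R nz Q0 by auto
    ultimately show False using qr(2) by simp
  qed
  then show ?case by (auto simp: C_def intro!: exI[of _ q])
qed

theorem map_poly_cyclotomic:
  assumes "n > 0"
  shows "map_poly of_int (cyclotomic n) = (\<Prod>z\<in>primitive_roots_of_unity n. [:- z, 1:])"
proof -
  obtain p :: "int poly"
    where p: "map_poly of_int p = (\<Prod>z\<in>primitive_roots_of_unity n. [:- z, 1:])"
    using ex_cyclotomic[OF assms] by blast
  show ?thesis
    unfolding cyclotomic_def by (rule theI[of _ p]) (use p map_poly_of_int_inj in auto)
qed

end

theory Submission
  imports Defs
    "HOL-Analysis.Kronecker_Approximation_Theorem"
    "HOL-Number_Theory.Cong"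
begin

text \<open>
  The orders on which \<open>f\<close> is a unit are closed under divisors. If \<open>f\<close> is not a generic unit, then
  arbitrarily many pairwise coprime orders fail, and by the Chinese remainder theorem arbitrarily long
  runs of consecutive integers consist of multiples of failing orders; so (3) implies (1).

  For (1) implies (4) one may assume that \<open>f\<close> is prime with \<open>f(0) \<noteq> 0\<close>. If \<open>f g = 1 + (X\<^sup>n - 1) h\<close>,
  then \<open>h(a) = 1 / (1 - a\<^sup>n)\<close> at the roots \<open>a\<close> of \<open>f\<close>, and for each \<open>k \<le> n\<close> there is an integer polynomial
  \<open>R\<^sub>k\<close> of degree below \<open>degree f\<close> with \<open>R\<^sub>k(a) = a\<^sup>n\<^sup>-\<^sup>k / (a\<^sup>n - 1)\<close>. By Dirichlet's approximation theorem
  there are arbitrarily large admissible \<open>n\<close> for which these values are bounded independently of \<open>n\<close>.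
  Only finitely many \<open>R\<^sub>k\<close> are then possible, so two of them coincide and every root is a root of
  unity. Irreducibility of cyclotomic polynomials gives \<open>f = \<plusminus>\<Phi>\<^sub>m\<close>, and the value \<open>\<Phi>\<^sub>m(1)\<close> decides
  which \<open>m\<close> occur: for \<open>n\<close> coprime to \<open>m\<close>, \<open>\<Phi>\<^sub>m\<close> divides \<open>\<Phi>\<^sub>m(X\<^sup>n) \<equiv> \<Phi>\<^sub>m(1)\<close> modulo \<open>X\<^sup>n - 1\<close>.
\<close>

section \<open>Units modulo \<open>X\<^sup>n - 1\<close>\<close>

lemma monom_diff_1_dvd:
  assumes "a dvd n"
  shows "(monom 1 a - 1 :: 'a::comm_ring_1 poly) dvd monom 1 n - 1"
proof -
  obtain c where "n = a * c" using assms by blast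
  then have "monom 1 n - 1 = (monom 1 a :: 'a poly) ^ c - 1 ^ c" by (simp add: monom_power mult.commute)
  then show ?thesis using power_diff_1_eq[of "monom 1 a :: 'a poly" c] by simp
qed

lemma degree_monom_diff_1: "n > 0 \<Longrightarrow> degree (monom 1 n - 1 :: 'a::comm_ring_1 poly) = n"
  using degree_add_eq_left[of "-1" "monom 1 n :: 'a poly"] by (simp add: degree_monom_eq)

lemma lead_coeff_monom_diff_1: "n > 0 \<Longrightarrow> lead_coeff (monom 1 n - 1 :: 'a::comm_ring_1 poly) = 1"
  by (simp add: degree_monom_diff_1)

lemma defines_unit_on_mult_iff:
  assumes "n > 0"
  shows "defines_unit_on (f * g) n \<longleftrightarrow> defines_unit_on f n \<and> defines_unit_on g n"
proof -
  let ?x = "monom 1 n - 1 :: int poly"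
  have "\<exists>h. ?x dvd (f * g) * h - 1" if "?x dvd f * u - 1" "?x dvd g * v - 1" for u v
  proof -
    have "?x dvd (f * u - 1) * (g * v) + (g * v - 1)" using that by (intro dvd_add dvd_mult2)
    then show ?thesis by (intro exI[of _ "u * v"]) (simp add: algebra_simps)
  qed
  moreover have "\<exists>u. ?x dvd f * u - 1" "\<exists>v. ?x dvd g * v - 1" if "?x dvd f * g * h - 1" for h
    using that by (auto intro: exI[of _ "g * h"] exI[of _ "f * h"] simp: ac_simps)
  ultimately show ?thesis using assms by (auto simp: defines_unit_on_iff_poly)
qed

lemma defines_unit_on_dvd:
  assumes "defines_unit_on f n" "a dvd n" "n > 0"
  shows "defines_unit_on f a"
proof -
  have "a > 0" using assms by (auto intro!: Nat.gr0I)
  then show ?thesis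
    using assms monom_diff_1_dvd[OF assms(2), where 'a = int]
    by (auto simp: defines_unit_on_iff_poly dest: dvd_trans)
qed

lemma defines_unit_on_is_unit: "is_unit f \<Longrightarrow> n > 0 \<Longrightarrow> defines_unit_on f n"
  by (auto simp: defines_unit_on_iff_poly elim!: dvdE[of f 1] intro: dvd_0_right)
     (metis diff_self dvd_0_right)

lemma defines_unit_on_uminus: "n > 0 \<Longrightarrow> defines_unit_on (- f) n \<longleftrightarrow> defines_unit_on f n"
  using defines_unit_on_mult_iff[of n "-1" f] defines_unit_on_is_unit[of "-1" n] by simp

lemma defines_unit_on_monom:
  assumes "n > 0"
  shows "defines_unit_on (monom 1 m) n"
proof -
  \<comment> \<open>The inverse of X^m is X^(n m - m); since n > 0, the subtraction is not
    truncated.\<close>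
  have "m + (n * m - m) = n * m" using assms by simp
  then have "monom 1 m * monom 1 (n * m - m) - (1 :: int poly) = monom 1 (n * m) - 1"
    by (simp add: mult_monom)
  then show ?thesis
    using assms monom_diff_1_dvd[of n "n * m"] by (metis defines_unit_on_iff_poly dvd_triv_left)
qed

lemma defines_unit_on_prod:
  "finite A \<Longrightarrow> n > 0 \<Longrightarrow> (\<And>i. i \<in> A \<Longrightarrow> defines_unit_on (F i) n) \<Longrightarrow> defines_unit_on (\<Prod>i\<in>A. F i) n"
  by (induction A rule: finite_induct) (auto simp: defines_unit_on_mult_iff defines_unit_on_is_unit)

text \<open>The substitution X = 1 kills X^n - 1 and so carries units to units of \<int>.\<close>

lemma defines_unit_on_poly_1:
  assumes "defines_unit_on f n" "n > 0"
  shows "is_unit (poly f 1)"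
proof -
  obtain g where "(monom 1 n - 1) dvd (f * g - 1)"
    using assms by (auto simp: defines_unit_on_iff_poly)
  then have "poly (monom 1 n - 1) 1 dvd poly (f * g - 1) 1"
    by (metis dvd_def poly_mult)
  then have "poly f 1 * poly g 1 = 1" by (simp add: poly_monom)
  then show ?thesis by (metis dvd_triv_left)
qed

lemma defines_generic_units_mult:
  assumes "defines_generic_units (f * g)"
  shows "defines_generic_units f" "defines_generic_units g"
  using assms unfolding defines_generic_units_def by (metis defines_unit_on_mult_iff)+

lemma defines_generic_units_poly_1:
  assumes "defines_generic_units f"
  shows "is_unit (poly f 1)"
proof -
  obtain D where "\<forall>n>0. coprime n D \<longrightarrow> defines_unit_on f n"
    using assms by (auto simp: defines_generic_units_def)
  then show ?thesis using defines_unit_on_poly_1[of f 1] by simp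
qed


section \<open>From bounded gaps to generic units\<close>

text \<open>Greedy choice: each new member is taken coprime to the product of the earlier ones. As
  members exceed 1, coprimality also makes it new.\<close>

lemma ex_coprime_family:
  assumes "\<And>D::nat. D > 0 \<Longrightarrow> \<exists>n>1. coprime n D \<and> P n"
  shows "\<exists>A. finite A \<and> card A = k \<and> pairwise coprime A \<and> (\<forall>a\<in>A. a > 1 \<and> P a)"
proof (induction k)
  case 0
  show ?case by (intro exI[of _ "{}"]) auto
next
  case (Suc k)
  then obtain A where A: "finite A" "card A = k" "pairwise coprime A" "\<forall>a\<in>A. a > 1 \<and> P a" by blast
  have "(\<Prod>a\<in>A. a) > 0" using A(4) by (intro prod_pos) auto
  then obtain n where n: "n > 1" "coprime n (\<Prod>a\<in>A. a)" "P n" using assms by blast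
  have c: "coprime n a" if "a \<in> A" for a
    using n(2) that A(1) coprime_divisors[of n n a "\<Prod>A"] dvd_prodI[of A a "\<lambda>x. x"] by simp
  then have "n \<notin> A" using n(1) by (metis coprime_self less_numeral_extra(4) nat_dvd_1_iff_1)
  then show ?case
    using A n c by (intro exI[of _ "insert n A"]) (auto simp: pairwise_insert coprime_commute)
qed

lemma ex_consecutive_multiples:
  assumes "finite A" "pairwise coprime A" "\<forall>a\<in>A. a > (0::nat)"
  shows "\<exists>n>0. \<forall>i<card A. \<exists>a\<in>A. a dvd n + i"
proof -
  obtain h where h: "bij_betw h {0..<card A} A" using ex_bij_betw_nat_finite[OF assms(1)] by blast
  have "\<forall>i\<in>{0..<card A}. \<forall>j\<in>{0..<card A}. i \<noteq> j \<longrightarrow> coprime (h i) (h j)"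
    by (intro ballI impI pairwiseD[OF assms(2)] bij_betw_apply[OF h])
       (use h in \<open>auto simp: bij_betw_def inj_on_def\<close>)
  \<comment> \<open>\<open>(h i - 1) * i\<close> represents the residue -i modulo \<open>h i\<close>
    by a natural number.\<close>
  then obtain x where x: "\<forall>i\<in>{0..<card A}. [x = (h i - 1) * i] (mod h i)"
    using chinese_remainder_nat[of "{0..<card A}" h "\<lambda>i. (h i - 1) * i"] by auto
  \<comment> \<open>Adding the product keeps all residues and makes \<open>n\<close> positive even
    if \<open>x\<close> is 0.\<close>
  define n where "n = x + (\<Prod>a\<in>A. a)"
  have "n > 0" using assms by (auto simp: n_def intro!: prod_pos)
  moreover have "h i \<in> A \<and> h i dvd n + i" if i: "i < card A" for i
  proof -
    have hA: "h i \<in> A" using h i by (auto simp: bij_betw_def)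
    then have "h i > 0" using assms(3) by blast
    then have "(h i - 1) * i + i = h i * i" by (cases "h i") auto
    moreover have "[x + i = (h i - 1) * i + i] (mod h i)"
      using x i by (intro cong_add) auto
    ultimately have "h i dvd x + i" by (simp add: cong_def mod_eq_0_iff_dvd)
    moreover have "h i dvd (\<Prod>a\<in>A. a)" using hA assms(1) by blast
    ultimately have "h i dvd (x + i) + (\<Prod>a\<in>A. a)" by (rule dvd_add)
    then show ?thesis using hA by (simp add: n_def ac_simps)
  qed
  ultimately show ?thesis by blast
qed

lemma defines_generic_units_if_bounded_gaps:
  assumes "\<forall>n>0. \<exists>m. n \<le> m \<and> m \<le> n + D \<and> defines_unit_on f m"
  shows "defines_generic_units f"
proof (rule ccontr)
  assume "\<not> defines_generic_units f"
  then have *: "\<exists>n>0. coprime n D \<and> \<not> defines_unit_on f n" if "D > 0" for D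
    using that unfolding defines_generic_units_def by blast
  \<comment> \<open>Order 1 divides every order and so cannot fail; the failing orders therefore
    exceed 1, as the coprime family requires.\<close>
  obtain m where "m \<ge> 1" "defines_unit_on f m" using assms by (metis zero_less_one)
  then have "defines_unit_on f 1" using defines_unit_on_dvd[of f m 1] by simp
  then have "\<exists>n>1. coprime n D \<and> \<not> defines_unit_on f n" if "D > 0" for D
    using *[OF that] by (metis One_nat_def Suc_lessI)
  from ex_coprime_family[OF this, of "Suc D"]
  obtain A where A: "finite A" "card A = Suc D" "pairwise coprime A"
    "\<forall>a\<in>A. a > 1 \<and> \<not> defines_unit_on f a" by auto
  then obtain n where n: "n > 0" "\<forall>i<Suc D. \<exists>a\<in>A. a dvd n + i"
    using ex_consecutive_multiples[of A] by fastforce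
  obtain m where m: "n \<le> m" "m \<le> n + D" "defines_unit_on f m" using assms n(1) by blast
  then have "m - n < Suc D" by linarith
  then obtain a where "a \<in> A" "a dvd m" using n(2) m(1) by (metis le_add_diff_inverse)
  then show False using A(4) m n(1) defines_unit_on_dvd[of f m a] by auto
qed

section \<open>Complex roots of integer polynomials\<close>

abbreviation cpoly :: "int poly \<Rightarrow> complex poly" where
  "cpoly \<equiv> map_poly of_int"

lemma cpoly_simps [simp]:
  "cpoly (p + q) = cpoly p + cpoly q" "cpoly (p - q) = cpoly p - cpoly q"
  "cpoly (- p) = - cpoly p" "cpoly (p * q) = cpoly p * cpoly q"
  "cpoly (smult c p) = smult (of_int c) (cpoly p)" "cpoly (monom c n) = monom (of_int c) n"
  by (simp_all add: poly_eq_iff coeff_map_poly map_poly_of_int_mult)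

lemma degree_cpoly [simp]: "degree (cpoly p) = degree p"
  by (intro degree_map_poly) auto

lemma cpoly_eq_0_iff [simp]: "cpoly p = 0 \<longleftrightarrow> p = 0"
  using map_poly_of_int_inj[of p 0] by auto

lemma cpoly_prod [simp]: "cpoly (\<Prod>i\<in>I. P i) = (\<Prod>i\<in>I. cpoly (P i))"
  by (rule map_poly_of_int_prod)

lemma cpoly_pcompose: "cpoly (pcompose p q) = pcompose (cpoly p) (cpoly q)"
  by (induction p) (simp_all add: pcompose_pCons map_poly_pCons)

lemma pderiv_cpoly: "pderiv (cpoly p) = cpoly (pderiv p)"
  by (rule poly_eqI) (simp add: coeff_pderiv coeff_map_poly)

lemma ex_cpoly_root:
  assumes "degree p > 0"
  shows "\<exists>z. poly (cpoly p) z = 0"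
proof -
  have "\<not> constant (poly (cpoly p))" using assms by (subst constant_degree) simp
  then show ?thesis by (rule fundamental_theorem_of_algebra)
qed

lemma poly_cpoly_eq_0: "p dvd q \<Longrightarrow> poly (cpoly p) z = 0 \<Longrightarrow> poly (cpoly q) z = 0"
  by (auto elim!: dvdE)

text \<open>
  A prime \<open>f\<close> with root \<open>z\<close> divides every integer polynomial vanishing at \<open>z\<close>: pseudo-divide
  both by a nonzero \<open>h\<close> of minimal degree vanishing at \<open>z\<close>.
\<close>

lemma prime_dvd_if_common_root:
  fixes f g :: "int poly"
  assumes f: "prime_elem f" and z: "poly (cpoly f) z = 0" "poly (cpoly g) z = 0"
  shows "f dvd g"
proof -
  define Q where "Q h \<longleftrightarrow> h \<noteq> 0 \<and> poly (cpoly h) z = 0" for h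
  have f0: "f \<noteq> 0" using f by auto
  have "Q f" using z f0 by (simp add: Q_def)
  define h where "h = arg_min degree Q"
  have Qh: "Q h" and hmin: "\<And>q. Q q \<Longrightarrow> degree h \<le> degree q"
    using arg_min_nat_lemma[where P = Q and m = degree, OF \<open>Q f\<close>] by (auto simp: h_def)
  then have h0: "h \<noteq> 0" and hz: "poly (cpoly h) z = 0" by (auto simp: Q_def)
  have deg_pos: "degree p > 0" if "p \<noteq> 0" "poly (cpoly p) z = 0" for p
    using that
    by (metis degree_cpoly degree_eq_zeroE gr0I cpoly_eq_0_iff poly_pCons poly_0 mult_zero_right
        add_0_right pCons_0_0)
  have div: "\<exists>c q. c \<noteq> 0 \<and> smult c p = h * q" if "poly (cpoly p) z = 0" for p
  proof -
    obtain c q r where r: "c \<noteq> 0" "smult c p = h * q + r" "r = 0 \<or> degree r < degree h"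
      using pseudo_mod[OF h0, of p] by blast
    have "r = smult c p - h * q" using r(2) by simp
    then have "poly (cpoly r) z = 0" using that hz by simp
    then have "r = 0" using r(3) hmin[of r] unfolding Q_def by linarith
    then show ?thesis using r by auto
  qed
  obtain c q where c: "c \<noteq> 0" "smult c f = h * q" using div z(1) by blast
  have "f dvd smult c f" by (rule dvd_smult) simp
  then have "f dvd h \<or> f dvd q" using f c(2) by (simp add: prime_elem_dvd_mult_iff)
  \<comment> \<open>Otherwise cancelling \<open>f\<close> makes \<open>h\<close> a divisor of a
    nonzero constant, although \<open>h\<close> has a root.\<close>
  moreover have "\<not> f dvd q"
  proof
    assume "f dvd q"
    then obtain u where "q = f * u" by blast
    then have "f * (h * u) = f * [:c:]" using c(2) by (simp add: ac_simps)
    then have "h * u = [:c:]" using f0 mult_left_cancel by blast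
    then have "h * u \<noteq> 0" "degree (h * u) = 0" using c(1) by auto
    then have "degree h = 0" by (auto simp: degree_mult_eq)
    then show False using deg_pos[OF h0 hz] by simp
  qed
  ultimately have "f dvd h" by blast
  obtain c' q' where c': "c' \<noteq> 0" "smult c' g = h * q'" using div z(2) by blast
  then have "f dvd [:c':] * g" using \<open>f dvd h\<close> by simp
  moreover have "\<not> f dvd [:c':]"
    using dvd_imp_degree_le[of f "[:c':]"] deg_pos[OF f0 z(1)] c'(1) by auto
  ultimately show ?thesis using f by (simp only: prime_elem_dvd_mult_iff) blast
qed

text \<open>All roots are simple: a root shared with the derivative would make \<open>f\<close>
  divide a nonzero polynomial of smaller degree.\<close>

lemma card_roots_prime:
  assumes "prime_elem f" "degree f > 0"
  shows "card {z. poly (cpoly f) z = 0} = degree f"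
proof -
  have f0: "f \<noteq> 0" using assms by auto
  have "poly (pderiv (cpoly f)) z \<noteq> 0" if "poly (cpoly f) z = 0" for z
  proof
    assume "poly (pderiv (cpoly f)) z = 0"
    then have "f dvd pderiv f"
      unfolding pderiv_cpoly by (rule prime_dvd_if_common_root[OF assms(1) that])
    moreover have "pderiv f \<noteq> 0" using assms(2) by (simp add: pderiv_eq_0_iff)
    ultimately show False
      using dvd_imp_degree_le[of f "pderiv f"] assms(2) by (simp add: degree_pderiv)
  qed
  then have "rsquarefree (cpoly f)" by (simp add: rsquarefree_roots)
  then have "degree (smult (lead_coeff (cpoly f)) (\<Prod>z | poly (cpoly f) z = 0. [:- z, 1:])) = degree (cpoly f)"
    by (subst complex_poly_decompose_rsquarefree) auto
  moreover have "degree (\<Prod>z | poly (cpoly f) z = 0. [:- z, 1:])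
      = (\<Sum>z | poly (cpoly f) z = 0. degree [:- z, 1:])"
    by (rule degree_prod_eq_sum_degree) auto
  ultimately show ?thesis using f0 by (simp add: coeff_map_poly)
qed

section \<open>Prime factors of generic units have roots of unity as roots\<close>

lemma finite_int_polys_bounded_coeffs:
  "finite {p::int poly. degree p < d \<and> (\<forall>i. \<bar>coeff p i\<bar> \<le> C)}" (is "finite ?S")
proof (rule inj_on_finite)
  show "inj_on (\<lambda>p. map (coeff p) [0..<d]) ?S"
  proof (rule inj_onI)
    fix p q assume pq: "p \<in> ?S" "q \<in> ?S" "map (coeff p) [0..<d] = map (coeff q) [0..<d]"
    then have "coeff p i = coeff q i" for i
      by (cases "i < d") (auto simp: coeff_eq_0)
    then show "p = q" by (rule poly_eqI)
  qed
  show "(\<lambda>p. map (coeff p) [0..<d]) ` ?S \<subseteq> {xs. set xs \<subseteq> {-C..C} \<and> length xs = d}"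
    by (auto simp: abs_le_iff) (metis minus_le_iff)
  show "finite {xs. set xs \<subseteq> {-C..C} \<and> length xs = d}" by (rule finite_lists_length_eq) simp
qed

lemma lagrange_interpolation:
  fixes p :: "'a::field poly"
  assumes "finite S" "degree p < card S"
  shows "p = (\<Sum>a\<in>S. smult (poly p a) (\<Prod>b\<in>S - {a}. smult (1 / (a - b)) [:- b, 1:]))" (is "p = ?q")
proof (rule poly_eqI_degree)
  show "poly p x = poly ?q x" if "x \<in> S" for x
  proof -
    have "poly ?q x = (\<Sum>a\<in>S. if a = x then poly p a else 0)"
      unfolding poly_sum
    proof (rule sum.cong)
      fix a assume a: "a \<in> S"
      show "poly (smult (poly p a) (\<Prod>b\<in>S - {a}. smult (1 / (a - b)) [:- b, 1:])) x
          = (if a = x then poly p a else 0)"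
      proof (cases "a = x")
        case True
        then have "poly (\<Prod>b\<in>S - {a}. smult (1 / (a - b)) [:- b, 1:]) x = 1"
          unfolding poly_prod
        proof (intro prod.neutral ballI)
          fix b assume "b \<in> S - {a}"
          then have "x - b \<noteq> 0" and b: "poly [:- b, 1:] x = x - b" using True by auto
          then show "poly (smult (1 / (a - b)) [:- b, 1:]) x = 1"
            unfolding poly_smult b using True by simp
        qed
        then show ?thesis using True by simp
      next
        case False
        then show ?thesis using that assms(1) by (auto simp: poly_prod)
      qed
    qed simp
    then show ?thesis using that assms(1) by simp
  qed
  have "degree (smult (poly p a) (\<Prod>b\<in>S - {a}. smult (1 / (a - b)) [:- b, 1:])) \<le> card S - 1"
    if "a \<in> S" for a
  proof -
    have "degree (\<Prod>b\<in>S - {a}. smult (1 / (a - b)) [:- b, 1:]) \<le> (\<Sum>b\<in>S - {a}. 1)"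
      using assms(1)
      by (intro order_trans[OF degree_prod_sum_le sum_mono] order_trans[OF degree_smult_le]) auto
    then show ?thesis using that assms(1) by (intro order_trans[OF degree_smult_le]) simp
  qed
  then have "degree ?q \<le> card S - 1" using assms(1) by (intro degree_sum_le) auto
  then show "degree ?q < card S" using assms by linarith
qed (use assms in auto)

text \<open>By Lagrange interpolation each coefficient is a linear combination of the values on
  \<open>S\<close> with weights depending only on \<open>S\<close>, so bounded values bound the
  integer coefficients.\<close>

lemma finite_int_polys_bounded_values:
  assumes "finite S" "card S = d"
  shows "finite {p. degree p < d \<and> (\<forall>a\<in>S. norm (poly (cpoly p) a) \<le> B)}"
proof -
  define L where "L a = (\<Prod>b\<in>S - {a}. smult (1 / (a - b)) [:- b, 1:])" for a
  \<comment> \<open>Summing over all \<open>i\<close> gives one bound for every coefficient;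
    \<open>\<bar>B\<bar>\<close> keeps the summands nonnegative when \<open>B\<close> is
    negative.\<close>
  define C where "C = (\<Sum>i<d. \<Sum>a\<in>S. \<bar>B\<bar> * norm (coeff (L a) i))"
  have "\<bar>coeff p i\<bar> \<le> \<lfloor>C\<rfloor>"
    if p: "degree p < d" "\<forall>a\<in>S. norm (poly (cpoly p) a) \<le> B" for p i
  proof -
    have C0: "(\<Sum>a\<in>S. \<bar>B\<bar> * norm (coeff (L a) i)) \<ge> 0" for i by (intro sum_nonneg) auto
    have "real_of_int \<bar>coeff p i\<bar> \<le> C"
    proof (cases "i < d")
      case True
      have "cpoly p = (\<Sum>a\<in>S. smult (poly (cpoly p) a) (L a))"
        using lagrange_interpolation[OF assms(1), of "cpoly p"] p(1) assms(2) by (simp add: L_def)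
      then have "coeff (cpoly p) i = (\<Sum>a\<in>S. poly (cpoly p) a * coeff (L a) i)"
        by (metis (no_types, lifting) coeff_smult coeff_sum sum.cong)
      moreover have "norm (poly (cpoly p) a) \<le> \<bar>B\<bar>" if "a \<in> S" for a
        using p(2) that by fastforce
      ultimately have "norm (of_int (coeff p i) :: complex) \<le> (\<Sum>a\<in>S. \<bar>B\<bar> * norm (coeff (L a) i))"
        by (auto simp: coeff_map_poly norm_mult intro!: sum_norm_le mult_right_mono)
      also have "\<dots> \<le> C"
        unfolding C_def using True C0 by (intro member_le_sum) auto
      finally show ?thesis by simp
    next
      case False
      then show ?thesis using p(1) C0 by (simp add: coeff_eq_0 C_def sum_nonneg)
    qed
    then show ?thesis by linarith
  qed
  then show ?thesis
    by (intro finite_subset[OF _ finite_int_polys_bounded_coeffs[of d "\<lfloor>C\<rfloor>"]]) auto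
qed

section \<open>Orders at which powers stay away from 1\<close>

lemma norm_cis_minus_1_le: "norm (cis t - 1) \<le> \<bar>t\<bar>"
proof -
  have "norm (cis t - 1) = 2 * \<bar>sin (t / 2)\<bar>"
    by (simp add: cis_conv_exp dist_exp_i_1)
  also have "\<dots> \<le> \<bar>t\<bar>" using abs_sin_x_le_abs_x[of "t / 2"] by simp
  finally show ?thesis .
qed

text \<open>Simultaneous Dirichlet approximation of the angles, measured in turns and scaled by
  \<open>c\<close>: one multiplier \<open>q\<close> brings all of them close to integers.\<close>

lemma unit_circle_recurrence:
  fixes S :: "complex set"
  assumes "finite S" "\<And>a. a \<in> S \<Longrightarrow> norm a = 1" "c > 0" "e > 0"
  shows "\<exists>q>0. \<forall>a\<in>S. norm (a ^ (q * c) - 1) < e"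
proof -
  obtain h where h: "bij_betw h {0..<card S} S" using ex_bij_betw_nat_finite[OF assms(1)] by blast
  define M where "M = Suc (nat \<lceil>2 * pi / e\<rceil>)"
  have M: "2 * pi * (1 / M) < e"
  proof -
    have "2 * pi / e < M" by (simp add: M_def) linarith
    moreover have "real M > 0" by (simp add: M_def)
    ultimately show ?thesis using assms(4) by (simp add: field_simps)
  qed
  obtain q p where q: "q > 0"
    "\<And>i. i < card S \<Longrightarrow> \<bar>of_int q * (c * Arg (h i) / (2 * pi)) - of_int (p i)\<bar> < 1 / M"
    using Dirichlet_approx_simult[of M "card S" "\<lambda>i. c * Arg (h i) / (2 * pi)"] M_def
    by (metis zero_less_Suc)
  have "norm (h i ^ (nat q * c) - 1) < e" if i: "i < card S" for i
  proof -
    define t where "t = of_int q * (c * Arg (h i) / (2 * pi)) - of_int (p i)"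
    have "h i \<in> S" using h i by (auto simp: bij_betw_def)
    then have "cis (Arg (h i)) = h i"
      using assms(2) rcis_cmod_Arg[of "h i"] by (simp add: rcis_def)
    then have "h i ^ (nat q * c) = cis (real (nat q * c) * Arg (h i))"
      using Complex.DeMoivre[of "Arg (h i)" "nat q * c"] by simp
    also have "real (nat q * c) * Arg (h i) = 2 * pi * t + 2 * pi * of_int (p i)"
      using q(1) by (simp add: t_def field_simps)
    also have "cis \<dots> = cis (2 * pi * t)" by (simp flip: cis_mult)
    finally have "norm (h i ^ (nat q * c) - 1) \<le> \<bar>2 * pi * t\<bar>" using norm_cis_minus_1_le by metis
    also have "\<dots> = 2 * pi * \<bar>t\<bar>" by (simp add: abs_mult)
    also have "\<dots> < 2 * pi * (1 / M)" using q(2)[OF i] unfolding t_def by (intro mult_strict_left_mono) auto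
    also note M
    finally show ?thesis .
  qed
  then have "\<forall>a\<in>S. norm (a ^ (nat q * c) - 1) < e"
    by (metis h atLeastLessThan_iff bij_betw_iff_bijections)
  then show ?thesis using q(1) by (intro exI[of _ "nat q"]) simp
qed

text \<open>Off the unit circle the quotients are bounded over all n > 0. On it, n is one more than
  a recurrence time, so a^n stays near a, which is not 1.\<close>

lemma ex_uniform_bound:
  fixes S :: "complex set"
  assumes S: "finite S" "1 \<notin> S" and D: "D > 0"
  shows "\<exists>B. \<forall>N. \<exists>n>N. coprime n D \<and> (\<forall>a\<in>S. \<forall>k\<le>n. a ^ n \<noteq> 1 \<and> norm (a ^ k / (a ^ n - 1)) \<le> B)"
proof -
  define C where "C a = (if norm a = 1 then 2 / norm (a - 1)
    else if norm a < 1 then 1 / (1 - norm a) else norm a / (norm a - 1))" for a :: complex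
  have C: "a ^ n \<noteq> 1 \<and> norm (a ^ k / (a ^ n - 1)) \<le> C a"
    if a: "a \<noteq> 1" "n > 0" "k \<le> n" "norm a = 1 \<Longrightarrow> norm (a ^ n - 1) \<ge> norm (a - 1) / 2" for a n k
  proof -
    have tri: "norm (a ^ n - 1) \<ge> \<bar>norm a ^ n - 1\<bar>"
      using norm_triangle_ineq3[of "a ^ n" 1] by (simp add: norm_power)
    consider "norm a = 1" | "norm a < 1" | "norm a > 1" by linarith
    then show ?thesis
    proof cases
      case 1
      then have *: "norm (a ^ n - 1) \<ge> norm (a - 1) / 2" "norm (a - 1) / 2 > 0" using a by auto
      then have "1 / norm (a ^ n - 1) \<le> 1 / (norm (a - 1) / 2)" by (intro frac_le) auto
      then show ?thesis using 1 * by (auto simp: C_def norm_divide norm_power)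
    next
      case 2
      then have "norm a ^ n \<le> norm a" using a(2) power_decreasing[of 1 n "norm a"] by simp
      then have *: "norm (a ^ n - 1) \<ge> 1 - norm a" using tri by linarith
      have "norm a ^ k \<le> 1" using 2 by (intro power_le_one) auto
      then have "norm a ^ k / norm (a ^ n - 1) \<le> 1 / (1 - norm a)"
        using * 2 by (intro frac_le) auto
      then show ?thesis using 2 * by (auto simp: C_def norm_divide norm_power)
    next
      case 3
      then have n: "norm a ^ n \<ge> norm a" using a(2) power_increasing[of 1 n "norm a"] by simp
      then have *: "norm (a ^ n - 1) \<ge> norm a ^ n - 1" using tri by linarith
      have "norm a ^ k \<le> norm a ^ n" using 3 a(3) by (intro power_increasing) auto
      then have "norm a ^ k / norm (a ^ n - 1) \<le> norm a ^ n / (norm a ^ n - 1)"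
        using * 3 n by (intro frac_le) auto
      \<comment> \<open>The function t / (t - 1) decreases for t > 1.\<close>
      also have "\<dots> \<le> norm a / (norm a - 1)"
        using 3 n by (auto simp: field_simps)
      finally show ?thesis using 3 * n by (auto simp: C_def norm_divide norm_power)
    qed
  qed
  define T where "T = {a \<in> S. norm a = 1}"
  \<comment> \<open>The inserted 1 keeps the minimum defined when \<open>S\<close> is empty.\<close>
  define e where "e = Min (insert 1 ((\<lambda>a. norm (a - 1) / 2) ` S))"
  have e: "e > 0" using S by (auto simp: e_def)
  have e_le: "e \<le> norm (a - 1) / 2" if "a \<in> S" for a
    unfolding e_def using S(1) that by (intro Min_le) auto
  have "\<exists>n>N. coprime n D \<and> (\<forall>a\<in>S. \<forall>k\<le>n. a ^ n \<noteq> 1 \<and> norm (a ^ k / (a ^ n - 1)) \<le> (\<Sum>a\<in>S. C a))" for N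
  proof -
    have T: "finite T" "\<And>a. a \<in> T \<Longrightarrow> norm a = 1" using S(1) by (auto simp: T_def)
    have "Suc N * D > 0" using D by simp
    from unit_circle_recurrence[OF T this e] obtain q
      where q: "q > 0" "\<forall>a\<in>T. norm (a ^ (q * (Suc N * D)) - 1) < e" by blast
    \<comment> \<open>The factor \<open>Suc N\<close> pushes \<open>n\<close> beyond
      \<open>N\<close>, the factor \<open>D\<close> makes \<open>n\<close> congruent to 1 modulo
      \<open>D\<close>, and the successor puts a^n near a instead of near 1.\<close>
    define n where "n = Suc (q * (Suc N * D))"
    have "1 * (Suc N * 1) \<le> q * (Suc N * D)" using q(1) D by (intro mult_le_mono) auto
    then have "n > N" by (simp add: n_def)
    have "coprime n D"
    proof (rule coprimeI)
      fix c assume "c dvd n" "c dvd D"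
      moreover have "n = D * (q * Suc N) + 1" by (simp add: n_def algebra_simps)
      ultimately show "is_unit c" by (metis dvd_add_right_iff dvd_mult2)
    qed
    have low: "norm (a ^ n - 1) \<ge> norm (a - 1) / 2" if a: "a \<in> S" "norm a = 1" for a
    proof -
      let ?b = "a ^ (q * (Suc N * D))"
      have "norm (a - 1) \<le> norm (a * ?b - 1) + norm (a - a * ?b)"
        using norm_triangle_ineq[of "a * ?b - 1" "a - a * ?b"] by simp
      also have "norm (a - a * ?b) = norm a * norm (?b - 1)"
        by (metis mult.right_neutral norm_minus_commute norm_mult right_diff_distrib)
      also have "\<dots> \<le> norm (a - 1) / 2"
        using q(2) e_le[OF a(1)] a by (auto simp: T_def intro: order_trans[OF less_imp_le])
      finally show ?thesis by (simp add: n_def)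
    qed
    have C_le: "C a \<le> (\<Sum>a\<in>S. C a)" if "a \<in> S" for a
      using S(1) that by (intro member_le_sum) (auto simp: C_def)
    have "a ^ n \<noteq> 1 \<and> norm (a ^ k / (a ^ n - 1)) \<le> (\<Sum>a\<in>S. C a)" if "a \<in> S" "k \<le> n" for a k
      using C[of a n k] C_le[OF that(1)] low[OF that(1)] that S(2) \<open>n > N\<close> by fastforce
    with \<open>n > N\<close> \<open>coprime n D\<close> show ?thesis by blast
  qed
  then show ?thesis by blast
qed

text \<open>
  With \<open>f g = 1 + (X\<^sup>n - 1) h\<close>, splitting \<open>g\<close> at \<open>X\<^sup>k\<close> shows that \<open>1 - h\<close> is divisible by \<open>X\<^sup>k\<close>
  modulo \<open>f\<close>; the quotient has degree below \<open>degree f\<close> even though \<open>f\<close> need not be monic.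
\<close>

lemma inverse_tail:
  fixes f :: "int poly"
  assumes "defines_unit_on f n" "n > 0" "degree f > 0" "k \<le> n"
  shows "\<exists>R. degree R < degree f \<and>
    (\<forall>a::complex. a \<noteq> 0 \<longrightarrow> poly (cpoly f) a = 0 \<longrightarrow> poly (cpoly R) a * (a ^ n - 1) = a ^ (n - k))"
proof -
  let ?x = "monom 1 n - 1 :: int poly"
  obtain g0 where g0: "?x dvd f * g0 - 1"
    using assms(1,2) by (auto simp: defines_unit_on_iff_poly)
  \<comment> \<open>Reducing the inverse below degree \<open>n\<close> is what forces
    \<open>degree h < degree f\<close> later.\<close>
  obtain q g where g: "g0 = ?x * q + g" "g = 0 \<or> degree g < degree ?x"
    using monic_division[OF lead_coeff_monom_diff_1[OF assms(2)], of g0] by blast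
  have "f * g - 1 = (f * g0 - 1) - ?x * (f * q)" unfolding g(1) by (simp add: algebra_simps)
  then have "?x dvd f * g - 1" using g0 by (metis dvd_diff dvd_triv_left)
  then obtain h where h: "f * g - 1 = ?x * h" by blast
  have f0: "f \<noteq> 0" using assms(3) by auto
  have x0: "?x \<noteq> 0" using lead_coeff_monom_diff_1[OF assms(2), where 'a = int] by force
  have dg: "degree g < n" using g(2) assms(2) by (auto simp: degree_monom_diff_1)
  have dh: "degree h < degree f"
  proof (cases "h = 0")
    case False
    then have "n + degree h = degree (f * g - 1)"
      unfolding h using x0 assms(2) by (simp add: degree_mult_eq degree_monom_diff_1)
    also have "\<dots> \<le> degree f + degree g"
      by (intro degree_diff_le degree_mult_le) simp
    finally show ?thesis using dg by linarith
  qed (use assms(3) in simp)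
  define A where "A = poly_cutoff k g"
  \<comment> \<open>Chosen so that X^k R = 1 - h - f A, with \<open>A\<close> the part of
    \<open>g\<close> below X^k. The right side has degree below k + degree f, which bounds the
    degree of \<open>R\<close> without dividing by \<open>f\<close>.\<close>
  define R where "R = f * poly_shift k g - monom 1 (n - k) * h"
  have "g = A + monom 1 k * poly_shift k g"
    by (rule poly_eqI) (auto simp: A_def coeff_poly_cutoff coeff_poly_shift coeff_monom_mult)
  then have fg: "f * g = f * A + monom 1 k * (f * poly_shift k g)"
    by (metis distrib_left mult.left_commute)
  have "monom 1 k * monom 1 (n - k) = (monom 1 n :: int poly)"
    using assms(4) by (simp add: mult_monom)
  then have mh: "monom 1 k * (monom 1 (n - k) * h) = monom 1 n * h"
    by (metis mult.assoc)
  have "monom 1 k * R = monom 1 k * (f * poly_shift k g) - monom 1 n * h"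
    by (simp only: R_def right_diff_distrib mh)
  also have "\<dots> = 1 - h - f * A"
    using h fg by (simp add: algebra_simps)
  finally have R: "monom 1 k * R = 1 - h - f * A" .
  have "degree R < degree f"
  proof (cases "R = 0")
    case False
    then have "k + degree R = degree (monom 1 k * R)" by (simp add: degree_mult_eq degree_monom_eq)
    also have "\<dots> < k + degree f"
      unfolding R
    proof (intro degree_diff_less)
      show "degree (f * A) < k + degree f"
      proof (cases "A = 0")
        case False
        then have "degree A < k"
          by (metis A_def coeff_poly_cutoff leading_coeff_0_iff)
        then show ?thesis using False f0 by (simp add: degree_mult_eq)
      qed (use assms(3) in simp)
    qed (use dh assms(3) in auto)
    finally show ?thesis by simp
  qed (use assms(3) in simp)
  moreover have "poly (cpoly R) a * (a ^ n - 1) = a ^ (n - k)"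
    if a: "a \<noteq> 0" "poly (cpoly f) a = 0" for a :: complex
  proof -
    have "poly (cpoly (f * g - 1)) a = poly (cpoly (?x * h)) a" using h by simp
    then have 1: "(a ^ n - 1) * poly (cpoly h) a = -1" using a by (simp add: poly_monom)
    have "poly (cpoly (monom 1 k * R)) a = poly (cpoly (1 - h - f * A)) a" using R by simp
    then have 2: "a ^ k * poly (cpoly R) a = 1 - poly (cpoly h) a" using a by (simp add: poly_monom)
    have "a ^ k * (poly (cpoly R) a * (a ^ n - 1)) = (1 - poly (cpoly h) a) * (a ^ n - 1)"
      by (simp flip: 2)
    also have "\<dots> = a ^ n" using 1 by (simp add: algebra_simps)
    also have "\<dots> = a ^ k * a ^ (n - k)" using assms(4) by (simp flip: power_add)
    finally show ?thesis using a(1) by simp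
  qed
  ultimately show ?thesis by blast
qed

lemma prime_generic_root_of_unity:
  fixes f :: "int poly"
  assumes f: "prime_elem f" "defines_generic_units f" and d: "degree f > 0" and f0: "poly f 0 \<noteq> 0"
    and z: "poly (cpoly f) z = 0"
  shows "\<exists>t>0. z ^ t = 1"
proof -
  define S where "S = {a. poly (cpoly f) a = 0}"
  have fnz: "f \<noteq> 0" using d by auto
  have S: "finite S" unfolding S_def using fnz by (intro poly_roots_finite) simp
  have cS: "card S = degree f" unfolding S_def by (rule card_roots_prime[OF f(1) d])
  have ev: "poly (cpoly f) (of_int c) = of_int (poly f c)" for c
    by (induction f) (simp_all add: map_poly_pCons)
  \<comment> \<open>The root 0 is excluded by hypothesis, the root 1 because f(1) is a unit.\<close>
  have S1: "1 \<notin> S" and S0: "0 \<notin> S"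
    using ev[of 1] ev[of 0] f0 defines_generic_units_poly_1[OF f(2)] by (auto simp: S_def)
  obtain D where D: "D > 0" "\<And>n. n > 0 \<Longrightarrow> coprime n D \<Longrightarrow> defines_unit_on f n"
    using f(2) by (auto simp: defines_generic_units_def)
  obtain B where B: "\<And>N. \<exists>n>N. coprime n D \<and>
      (\<forall>a\<in>S. \<forall>k\<le>n. a ^ n \<noteq> 1 \<and> norm (a ^ k / (a ^ n - 1)) \<le> B)"
    using ex_uniform_bound[OF S S1 D(1)] by blast
  define P where "P = {p. degree p < degree f \<and> (\<forall>a\<in>S. norm (poly (cpoly p) a) \<le> B)}"
  have P: "finite P" unfolding P_def by (rule finite_int_polys_bounded_values[OF S cS])
  \<comment> \<open>The n + 1 polynomials R 0, ..., R n will lie in \<open>P\<close>, so two of them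
    must coincide.\<close>
  obtain n where n: "n > card P" "coprime n D"
    and nB: "\<And>a k. a \<in> S \<Longrightarrow> k \<le> n \<Longrightarrow> a ^ n \<noteq> 1 \<and> norm (a ^ k / (a ^ n - 1)) \<le> B"
    using B by blast
  have "n > 0" using n(1) by simp
  then have "defines_unit_on f n" using D(2) n(2) by blast
  from inverse_tail[OF this \<open>n > 0\<close> d]
  obtain R where R: "\<And>k. k \<le> n \<Longrightarrow> degree (R k) < degree f"
    "\<And>k a. k \<le> n \<Longrightarrow> a \<in> S \<Longrightarrow> poly (cpoly (R k)) a * (a ^ n - 1) = a ^ (n - k)"
    using S0 unfolding S_def mem_Collect_eq by metis
  have R': "poly (cpoly (R k)) a = a ^ (n - k) / (a ^ n - 1)" if "k \<le> n" "a \<in> S" for k a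
    using R(2)[OF that] nB[OF that(2,1)] by (simp add: eq_divide_eq)
  have "R k \<in> P" if "k \<le> n" for k
    using R(1)[OF that] R'[OF that] nB[of _ "n - k"] by (auto simp: P_def)
  then have "R ` {..n} \<subseteq> P" by auto
  then have "card (R ` {..n}) < card {..n}" using n(1) card_mono[OF P, of "R ` {..n}"] by simp
  then have "\<not> inj_on R {..n}" using pigeonhole by blast
  then obtain i j where ij: "i \<le> n" "j \<le> n" "i \<noteq> j" "R i = R j" by (auto simp: inj_on_def)
  have zS: "z \<in> S" using z by (simp add: S_def)
  have *: "\<exists>t>0. z ^ t = 1" if "i < j" "j \<le> n" "R i = R j" for i j
  proof -
    have "z ^ (n - i) = z ^ (n - j)"
      using R(2)[OF _ zS, of i] R(2)[OF _ zS, of j] that by simp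
    moreover have "n - i = (n - j) + (j - i)" using that by simp
    ultimately have "z ^ (n - j) * z ^ (j - i) = z ^ (n - j) * 1" by (simp flip: power_add)
    moreover have "z \<noteq> 0" using zS S0 by auto
    ultimately have "z ^ (j - i) = 1" by simp
    then show ?thesis using that by (intro exI[of _ "j - i"]) simp
  qed
  show ?thesis
    using *[of i j] *[of j i] ij by (metis linorder_neqE_nat)
qed

section \<open>Cyclotomic polynomials\<close>

lemma primitive_root_power_eq_1_iff:
  assumes "z \<in> primitive_roots_of_unity n" "n > 0"
  shows "z ^ j = 1 \<longleftrightarrow> n dvd j"
proof
  have zn: "z ^ n = 1" "\<And>k. 0 < k \<Longrightarrow> k < n \<Longrightarrow> z ^ k \<noteq> 1"
    using assms(1) by (auto simp: primitive_roots_of_unity_def)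
  have "z ^ j = z ^ (n * (j div n)) * z ^ (j mod n)" by (simp flip: power_add)
  then have "z ^ j = z ^ (j mod n)" using zn(1) by (simp add: power_mult)
  then show "n dvd j" if "z ^ j = 1"
    using zn(2)[of "j mod n"] that assms(2) by (metis dvd_eq_mod_eq_0 gr0I mod_less_divisor)
  show "z ^ j = 1" if "n dvd j" using that zn(1) by (auto simp: power_mult)
qed

lemma primitive_root_of_unityI:
  assumes "n > 0" "\<And>j. z ^ j = 1 \<longleftrightarrow> n dvd j"
  shows "z \<in> primitive_roots_of_unity n"
  using assms by (auto simp: primitive_roots_of_unity_def dest: dvd_imp_le)

lemma ex_primitive_root_of_unity:
  fixes z :: complex
  assumes "t > 0" "z ^ t = 1"
  shows "\<exists>n>0. z \<in> primitive_roots_of_unity n"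
proof -
  have "z \<in> (\<Union>d\<in>{d. d dvd t}. primitive_roots_of_unity d)"
    using roots_of_unity_eq_UN[OF assms(1)] assms(2) by blast
  then obtain d where "d dvd t" "z \<in> primitive_roots_of_unity d" by blast
  moreover from this have "d > 0" using assms(1) by (auto intro!: Nat.gr0I)
  ultimately show ?thesis by blast
qed

lemma primitive_root_power:
  assumes "z \<in> primitive_roots_of_unity n" "n > 0" "coprime k n"
  shows "z ^ k \<in> primitive_roots_of_unity n"
proof (rule primitive_root_of_unityI)
  show "(z ^ k) ^ j = 1 \<longleftrightarrow> n dvd j" for j
    using primitive_root_power_eq_1_iff[OF assms(1,2), of "k * j"] assms(3)
    by (simp add: power_mult coprime_dvd_mult_right_iff coprime_commute)
qed fact

text \<open>The powers of \<open>z\<close> with exponent below \<open>n\<close> are \<open>n\<close>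
  distinct n-th roots of unity, hence all of them; primitivity of \<open>w\<close> makes the
  exponent coprime to \<open>n\<close>.\<close>

lemma primitive_root_is_power:
  assumes z: "z \<in> primitive_roots_of_unity n" and w: "w \<in> primitive_roots_of_unity n" and n: "n > 0"
  shows "\<exists>j>0. coprime j n \<and> w = z ^ j"
proof -
  note z1 = primitive_root_power_eq_1_iff[OF z n] and w1 = primitive_root_power_eq_1_iff[OF w n]
  have z0: "z \<noteq> 0" using z n by (auto simp: primitive_roots_of_unity_def power_0_left)
  have le: "i = j" if "z ^ i = z ^ j" "i \<le> j" "j < n" for i j
  proof -
    have "z ^ i * z ^ (j - i) = z ^ j" using that(2) by (simp flip: power_add)
    then have "z ^ i * z ^ (j - i) = z ^ i * 1" using that(1) by simp
    then have "n dvd j - i" using z0 z1 by simp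
    then show ?thesis using that by (auto dest: dvd_imp_le)
  qed
  have inj: "inj_on (\<lambda>j. z ^ j) {..<n}"
    by (rule inj_onI) (metis le lessThan_iff nat_le_linear)
  have "(\<lambda>j. z ^ j) ` {..<n} = {x. x ^ n = 1}"
  proof (rule card_subset_eq)
    show "finite {x::complex. x ^ n = 1}" using n by (intro finite_roots_unity) auto
    show "(\<lambda>j. z ^ j) ` {..<n} \<subseteq> {x. x ^ n = 1}" using z1 by (auto simp flip: power_mult)
    show "card ((\<lambda>j. z ^ j) ` {..<n}) = card {x::complex. x ^ n = 1}"
      using n by (simp add: card_image[OF inj] card_roots_unity_eq)
  qed
  moreover have "w ^ n = 1" using w1 by simp
  ultimately obtain j where j: "w = z ^ j" by auto
  have "coprime j n"
  proof (rule coprimeI)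
    fix c assume c: "c dvd j" "c dvd n"
    obtain d where d: "n = c * d" using c(2) by blast
    obtain e where e: "j = c * e" using c(1) by blast
    have "w ^ d = 1" unfolding j using z1[of "j * d"] d e by (simp add: power_mult)
    then have "n dvd d" by (simp add: w1)
    then show "is_unit c" using d n by simp
  qed
  \<comment> \<open>The exponent can be 0 when n = 1; adding \<open>n\<close> makes it positive
    without changing the power.\<close>
  then have "coprime (j + n) n" by (simp add: coprime_iff_gcd_eq_1)
  moreover have "w = z ^ (j + n)" using j z1[of n] by (simp add: power_add)
  ultimately show ?thesis using n by (intro exI[of _ "j + n"]) simp
qed

lemma poly_cyclotomic_eq_0_iff:
  "n > 0 \<Longrightarrow> poly (cpoly (cyclotomic n)) z = 0 \<longleftrightarrow> z \<in> primitive_roots_of_unity n"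
  using finite_primitive_roots[of n] by (simp add: map_poly_cyclotomic poly_prod)

lemma lead_coeff_cyclotomic:
  assumes "n > 0"
  shows "lead_coeff (cyclotomic n) = 1"
proof -
  have "lead_coeff (cpoly (cyclotomic n)) = 1"
    unfolding map_poly_cyclotomic[OF assms] by (simp add: lead_coeff_prod)
  then show ?thesis by (simp add: coeff_map_poly)
qed

lemma prod_linear_dvd:
  fixes p :: "'a::field poly"
  assumes "finite A" "\<And>z. z \<in> A \<Longrightarrow> poly p z = 0"
  shows "(\<Prod>z\<in>A. [:- z, 1:]) dvd p"
  using assms
proof (induction A)
  case (insert a A)
  then obtain q where q: "p = (\<Prod>z\<in>A. [:- z, 1:]) * q" by (auto elim: dvdE)
  have "poly (\<Prod>z\<in>A. [:- z, 1:]) a \<noteq> 0" using insert.hyps by (auto simp: poly_prod)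
  then have "poly q a = 0" using insert.prems[of a] q by simp
  then have "[:- a, 1:] dvd q" by (simp add: poly_eq_0_iff_dvd)
  then have "[:- a, 1:] * (\<Prod>z\<in>A. [:- z, 1:]) dvd q * (\<Prod>z\<in>A. [:- z, 1:])"
    by (rule mult_dvd_mono) simp
  then show ?case unfolding q prod.insert[OF insert.hyps] by (simp only: mult.commute)
qed simp

text \<open>Division by a monic polynomial stays over \<int>, and a nonzero remainder has too small
  a degree to be divisible by \<open>p\<close> over the complex numbers.\<close>

lemma dvd_if_cpoly_dvd:
  assumes "lead_coeff p = 1" "cpoly p dvd cpoly q"
  shows "p dvd q"
proof -
  obtain u r where r: "q = p * u + r" "r = 0 \<or> degree r < degree p"
    using monic_division[OF assms(1)] by blast
  have "cpoly p dvd cpoly r"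
    using assms(2) unfolding r(1) by (simp add: dvd_add_right_iff)
  then have "r = 0" using r(2) dvd_imp_degree_le[of "cpoly p" "cpoly r"]
    by (metis cpoly_eq_0_iff degree_cpoly not_le)
  then show ?thesis using r(1) by simp
qed

lemma cyclotomic_dvdI:
  assumes "n > 0" "\<And>z. z \<in> primitive_roots_of_unity n \<Longrightarrow> poly (cpoly g) z = 0"
  shows "cyclotomic n dvd g"
proof (rule dvd_if_cpoly_dvd)
  show "cpoly (cyclotomic n) dvd cpoly g"
    unfolding map_poly_cyclotomic[OF assms(1)]
    by (rule prod_linear_dvd) (use assms finite_primitive_roots in auto)
qed (rule lead_coeff_cyclotomic[OF assms(1)])

lemma prod_cyclotomic:
  assumes "n > 0"
  shows "(\<Prod>d | d dvd n. cyclotomic d) = monom 1 n - 1"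
proof (rule map_poly_of_int_inj)
  have "(\<Prod>d | d dvd n. cpoly (cyclotomic d))
      = (\<Prod>d | d dvd n. \<Prod>z\<in>primitive_roots_of_unity d. [:- z, 1:])"
    using assms by (intro prod.cong map_poly_cyclotomic) (auto intro: Nat.gr0I)
  then show "cpoly (\<Prod>d | d dvd n. cyclotomic d) = cpoly (monom 1 n - 1)"
    using monom_diff_1_eq_prod_primitive[OF assms] by simp
qed

text \<open>Raising to a power coprime to \<open>m\<close> sends primitive m-th roots of unity to
  primitive ones.\<close>

lemma cyclotomic_dvd_pcompose:
  assumes "m > 0" "coprime n m"
  shows "cyclotomic m dvd pcompose (cyclotomic m) (monom 1 n)"
  using assms primitive_root_power[of _ m n]
  by (intro cyclotomic_dvdI) (auto simp: cpoly_pcompose poly_pcompose poly_monom poly_cyclotomic_eq_0_iff)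

lemma diff_dvd_pcompose_diff: "a - b dvd pcompose p a - pcompose p (b :: 'a::comm_ring_1 poly)"
proof (induction p)
  case (pCons c p)
  have "pcompose (pCons c p) a - pcompose (pCons c p) b
      = (a - b) * pcompose p a + b * (pcompose p a - pcompose p b)"
    by (simp add: pcompose_pCons algebra_simps)
  then show ?case using pCons.IH by (metis dvd_add dvd_mult dvd_triv_left)
qed simp

lemma defines_unit_on_cyclotomic:
  assumes "m > 0" "n > 0" "coprime n m" "is_unit (poly (cyclotomic m) 1)"
  shows "defines_unit_on (cyclotomic m) n"
proof -
  let ?c = "poly (cyclotomic m) 1"
  obtain h where h: "pcompose (cyclotomic m) (monom 1 n) = cyclotomic m * h"
    using cyclotomic_dvd_pcompose[OF assms(1,3)] by blast
  have "pcompose p 1 = [:poly p 1:]" for p :: "int poly"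
    by (induction p) (simp_all add: pcompose_pCons)
  then have "monom 1 n - 1 dvd cyclotomic m * h - [:?c:]"
    using diff_dvd_pcompose_diff[of "monom 1 n" 1 "cyclotomic m"] h by simp
  \<comment> \<open>The value at 1 is \<plusminus>1, hence its own inverse; multiplying by it turns
    \<open>h\<close> into an inverse.\<close>
  then have "monom 1 n - 1 dvd [:?c:] * (cyclotomic m * h - [:?c:])" by (rule dvd_mult)
  moreover have "?c * ?c = 1" using assms(4) by (metis abs_mult_self_eq mult_1 zdvd1_eq)
  then have "[:?c:] * [:?c:] = 1" by (simp add: one_pCons)
  ultimately have "monom 1 n - 1 dvd cyclotomic m * ([:?c:] * h) - 1"
    by (simp add: right_diff_distrib ac_simps)
  then show ?thesis unfolding defines_unit_on_iff_poly[OF assms(2)] by blast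
qed

section \<open>Values of cyclotomic polynomials at 1\<close>

lemma factor_monom_diff_1_at_1:
  fixes p q :: "int poly"
  assumes "monom 1 n - 1 = p * (monom 1 k - 1) * q"
  shows "int n = poly p 1 * int k * poly q 1"
proof -
  have "poly (pderiv (monom 1 n - 1)) 1 = poly (pderiv (p * (monom 1 k - 1) * q)) (1::int)"
    using assms by simp
  \<comment> \<open>Only the product-rule term that differentiates X^k - 1 survives at 1.\<close>
  then show ?thesis
    by (simp add: pderiv_mult pderiv_diff pderiv_monom poly_monom)
qed

text \<open>For m = p^k the divisors other than \<open>m\<close> are those of m/p, so X^m - 1 =
  \<Phi>_m (X^(m/p) - 1); derivatives at 1 give \<Phi>_m(1) = p.\<close>

lemma cyclotomic_primepow_at_1:
  assumes "primepow m"
  shows "\<not> is_unit (poly (cyclotomic m) 1)"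
proof -
  obtain p k where p: "prime p" "k > 0" "m = p ^ k" using assms by (auto simp: primepow_def)
  then have m: "m > 0" "m = p * p ^ (k - 1)" by (auto simp: prime_gt_0_nat simp flip: power_Suc)
  have "{d. d dvd m} = insert m {d. d dvd p ^ (k - 1)}"
    using p by (cases k) (auto simp: divides_primepow_nat le_Suc_eq simp del: power_Suc)
  moreover have "\<not> m dvd p ^ (k - 1)"
    using p power_dvd_imp_le[of p k "k - 1"] prime_gt_1_nat[of p] by auto
  ultimately have "monom 1 m - 1 = cyclotomic m * (monom 1 (p ^ (k - 1)) - 1) * 1"
    using p m by (simp flip: prod_cyclotomic)
  from factor_monom_diff_1_at_1[OF this] have "poly (cyclotomic m) 1 = int p"
    using m p by simp
  then show ?thesis using p(1) by (auto simp: prime_nat_iff)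
qed

text \<open>For each proper divisor a of m, a \<Phi>_m(1) divides m. If a prime p divided
  \<Phi>_m(1), the full p-part of m would be such an a, since m is no prime power, and m would
  contain one more factor p.\<close>

lemma cyclotomic_at_1:
  assumes "m > 1" "\<not> primepow m"
  shows "is_unit (poly (cyclotomic m) 1)"
proof (rule ccontr)
  let ?c = "poly (cyclotomic m) 1"
  assume "\<not> is_unit ?c"
  have key: "int a * ?c dvd int m" if a: "a dvd m" "a \<noteq> m" for a
  proof -
    have a0: "a > 0" using assms(1) a by (auto intro: Nat.gr0I)
    let ?E = "{d. d dvd m} - {d. d dvd a} - {m}"
    have m: "m \<notin> {d. d dvd a}" using a by (auto dest: dvd_antisym)
    have "{d. d dvd m} = insert m ({d. d dvd a} \<union> ?E)" using a by (auto dest: dvd_trans)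
    then have "(\<Prod>d | d dvd m. cyclotomic d) = (\<Prod>d\<in>insert m ({d. d dvd a} \<union> ?E). cyclotomic d)" by simp
    also have "\<dots> = cyclotomic m * (\<Prod>d\<in>{d. d dvd a} \<union> ?E. cyclotomic d)"
      using m assms(1) a0 by (subst prod.insert) auto
    also have "(\<Prod>d\<in>{d. d dvd a} \<union> ?E. cyclotomic d) = (\<Prod>d | d dvd a. cyclotomic d) * (\<Prod>d\<in>?E. cyclotomic d)"
      using assms(1) a0 by (intro prod.union_disjoint) auto
    finally have "monom 1 m - 1 = cyclotomic m * (monom 1 a - 1) * (\<Prod>d\<in>?E. cyclotomic d)"
      using assms(1) a0 by (simp add: prod_cyclotomic mult.assoc)
    from factor_monom_diff_1_at_1[OF this] show ?thesis by (simp add: mult.commute)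
  qed
  \<comment> \<open>With a = 1: the value is nonzero, and its prime divisors divide
    \<open>m\<close>.\<close>
  have "?c dvd int m" using key[of 1] assms(1) by simp
  moreover obtain q where q: "prime q" "q dvd ?c"
    using \<open>\<not> is_unit ?c\<close> calculation assms(1) prime_divisor_exists[of ?c] by fastforce
  ultimately have "q dvd int m" by (blast intro: dvd_trans)
  define p where "p = nat q"
  have "q = int p" using prime_ge_0_int[OF q(1)] by (simp add: p_def)
  then have p: "prime p" "int p dvd ?c" "p dvd m"
    using q \<open>q dvd int m\<close> by simp_all
  define a where "a = p ^ multiplicity p m"
  have "a dvd m" by (simp add: a_def multiplicity_dvd)
  moreover have "a \<noteq> m"
  proof
    assume "a = m"
    then have "m = p ^ multiplicity p m" by (simp add: a_def)
    moreover have "multiplicity p m > 0" using p assms(1) by (simp add: prime_multiplicity_gt_zero_iff)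
    ultimately show False using assms(2) p(1) unfolding primepow_def by blast
  qed
  ultimately have "int a * ?c dvd int m" by (rule key)
  then have "int a * int p dvd int m" using p(2) by (meson dvd_trans mult_dvd_mono dvd_refl)
  then have "int (p ^ Suc (multiplicity p m)) dvd int m" by (simp add: a_def mult.commute)
  then have "p ^ Suc (multiplicity p m) dvd m" by (simp only: of_nat_dvd_iff)
  then have "Suc (multiplicity p m) \<le> multiplicity p m"
    using p(1) assms(1) by (intro multiplicity_geI) (auto dest: not_prime_unit)
  then show False by simp
qed

section \<open>Irreducibility of cyclotomic polynomials\<close>

lemma prime_dvd_binomial_power_diff:
  fixes a b :: "'a::comm_ring_1"
  assumes "prime p"
  shows "of_nat p dvd (a + b) ^ p - (a ^ p + b ^ p)"
proof -
  have p: "p > 0" using assms by (simp add: prime_gt_0_nat)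
  have "{..p} = insert 0 (insert p {0<..<p})" using p by auto
  then have "(a + b) ^ p = b ^ p + (a ^ p + (\<Sum>k\<in>{0<..<p}. of_nat (p choose k) * a ^ k * b ^ (p - k)))"
    unfolding binomial_ring using p by simp
  moreover have "of_nat p dvd (\<Sum>k\<in>{0<..<p}. of_nat (p choose k) * a ^ k * b ^ (p - k))"
  proof (intro dvd_sum dvd_mult2)
    fix k assume "k \<in> {0<..<p}"
    then have "p dvd p choose k" using assms by (intro dvd_choose_prime) auto
    then show "(of_nat p :: 'a) dvd of_nat (p choose k)" by (metis dvd_def of_nat_mult)
  qed
  ultimately show ?thesis by simp
qed

lemma prime_dvd_int_power_diff:
  assumes "prime p"
  shows "int p dvd c ^ p - c"
proof -
  have "int p dvd int n ^ p - int n" for n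
  proof (induction n)
    case (Suc n)
    have "int p dvd ((int n + 1) ^ p - (int n ^ p + 1 ^ p)) + (int n ^ p - int n)"
      using prime_dvd_binomial_power_diff[OF assms, of "int n" 1] Suc by (intro dvd_add) auto
    then show ?case by (simp add: algebra_simps)
  qed (use prime_gt_0_nat[OF assms] in \<open>simp add: zero_power\<close>)
  note nonneg = this
  obtain n where "c = int n \<or> c = - int n" by (metis int_cases2)
  then show ?thesis
  proof
    assume c: "c = - int n"
    show ?thesis
    \<comment> \<open>For odd \<open>p\<close> the sign passes through the power; for p = 2 parity
      suffices.\<close>
    proof (cases "p = 2")
      case True
      then show ?thesis by simp
    next
      case False
      then have "odd p" using prime_odd_nat[OF assms] prime_ge_2_nat[OF assms] by simp
      then have "c ^ p - c = - (int n ^ p - int n)" using c by simp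
      then show ?thesis using nonneg[of n] by (metis dvd_minus_iff)
    qed
  qed (use nonneg in simp)
qed

text \<open>Induction on the form c + X g: modulo \<open>p\<close> the power splits over the sum,
  Fermat's little theorem handles c^p, and (X g)^p = X^p g^p.\<close>

lemma prime_dvd_power_diff_pcompose:
  fixes g :: "int poly"
  assumes "prime p"
  shows "of_nat p dvd g ^ p - pcompose g (monom 1 p)"
proof (induction g)
  case 0
  then show ?case using prime_gt_0_nat[OF assms] by (simp add: zero_power)
next
  case (pCons c g)
  have X: "pCons c g = [:c:] + monom 1 1 * g" by (simp add: monom_altdef)
  have c: "(of_nat p :: int poly) dvd [:c:] ^ p - [:c:]"
  proof -
    obtain d where "c ^ p - c = int p * d" using prime_dvd_int_power_diff[OF assms] by blast
    then have "[:c:] ^ p - [:c:] = of_nat p * [:d:]" by (simp add: poly_const_pow of_nat_poly)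
    then show ?thesis by (metis dvd_triv_left)
  qed
  have "(of_nat p :: int poly) dvd (([:c:] + monom 1 1 * g) ^ p - ([:c:] ^ p + (monom 1 1 * g) ^ p))
      + ([:c:] ^ p - [:c:]) + monom 1 p * (g ^ p - pcompose g (monom 1 p))"
    using prime_dvd_binomial_power_diff[OF assms] c pCons.IH by (intro dvd_add dvd_mult)
  also have "\<dots> = pCons c g ^ p - pcompose (pCons c g) (monom 1 p)"
    unfolding pcompose_pCons[of c g] unfolding X
    by (simp add: power_mult_distrib monom_power algebra_simps)
  finally show ?case .
qed

text \<open>Modulo \<open>f\<close>, which is monic up to sign, the powers of X below
  \<open>degree f\<close> form a basis, so divisibility between constants can be read off at
  coefficient 0.\<close>

lemma const_dvd_mult_mod_monic:
  fixes f :: "int poly"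
  assumes "is_unit (lead_coeff f)" "degree f > 0" "f dvd [:a:] - [:b:] * k"
  shows "b dvd a"
proof -
  let ?e = "lead_coeff f"
  define f1 where "f1 = smult ?e f"
  have e: "?e * ?e = 1" using assms(1) by (metis abs_mult_self_eq mult_1 zdvd1_eq)
  then have "?e \<noteq> 0" by force
  then have f1: "lead_coeff f1 = 1" "degree f1 = degree f" using e by (auto simp: f1_def)
  have "f = smult ?e f1" using e by (simp add: f1_def)
  then have "f1 dvd f" by (metis dvd_refl dvd_smult)
  obtain q r where r: "k = f1 * q + r" "r = 0 \<or> degree r < degree f1"
    using monic_division[OF f1(1)] by blast
  have "[:a:] - [:b:] * r = ([:a:] - [:b:] * k) + f1 * ([:b:] * q)"
    unfolding r(1) by (simp add: algebra_simps)
  moreover have "f1 dvd \<dots>"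
    using dvd_trans[OF \<open>f1 dvd f\<close> assms(3)] by (rule dvd_add) (rule dvd_triv_left)
  ultimately have "f1 dvd [:a:] - [:b:] * r" by (simp only:)
  moreover have "degree ([:a:] - [:b:] * r) < degree f1"
    using r(2) assms(2) f1(2) degree_smult_le[of b r] by (intro degree_diff_less) auto
  ultimately have "[:a:] - [:b:] * r = 0" using dvd_imp_degree_le by (metis not_le)
  then have "coeff ([:a:] - [:b:] * r) 0 = 0" by simp
  then show ?thesis by simp
qed

text \<open>
  If \<open>X\<^sup>n - 1 = f g\<close> and \<open>z\<^sup>p\<close> were a root of \<open>g\<close>, then \<open>g(z)\<^sup>p\<close> would lie in \<open>p \<int>[z]\<close> by Frobenius,
  while differentiating at \<open>z\<close> gives \<open>z f'(z) g(z) = n\<close>; so \<open>p\<close> would divide \<open>n\<^sup>p\<close>.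
\<close>

lemma root_prime_power:
  fixes f :: "int poly"
  assumes f: "prime_elem f" "poly (cpoly f) z = 0" and n: "n > 0" "z ^ n = 1"
    and p: "prime p" "\<not> p dvd n"
  shows "poly (cpoly f) (z ^ p) = 0"
proof (rule ccontr)
  assume nz: "poly (cpoly f) (z ^ p) \<noteq> 0"
  have "f dvd monom 1 n - 1"
    using n(2) by (intro prime_dvd_if_common_root[OF f]) (simp add: poly_monom)
  then obtain g where g: "monom 1 n - 1 = f * g" by blast
  \<comment> \<open>This makes \<open>f\<close> monic up to sign, as the final descent from
    \<int>[X]/(f) to \<int> requires.\<close>
  have "lead_coeff f * lead_coeff g = 1"
    using lead_coeff_monom_diff_1[OF n(1), where 'a = int] unfolding g by (simp add: lead_coeff_mult)
  then have lf: "is_unit (lead_coeff f)" by (metis dvd_triv_left)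
  have df: "degree f > 0"
  proof (rule ccontr)
    assume "\<not> degree f > 0"
    then obtain c where c: "f = [:c:]" by (metis degree_eq_zeroE gr0I)
    then show False using f by (auto simp: map_poly_pCons)
  qed
  have "poly (cpoly (monom 1 n - 1)) (z ^ p) = 0"
    using n(2) by (simp add: poly_monom flip: power_mult) (simp add: power_mult mult.commute)
  then have "poly (cpoly g) (z ^ p) = 0" unfolding g using nz by simp
  then have "f dvd pcompose g (monom 1 p)"
    by (intro prime_dvd_if_common_root[OF f]) (simp add: cpoly_pcompose poly_pcompose poly_monom)
  then obtain u where u: "pcompose g (monom 1 p) = f * u" by blast
  obtain k where k: "g ^ p - pcompose g (monom 1 p) = of_nat p * k"
    using prime_dvd_power_diff_pcompose[OF p(1)] by blast
  let ?X = "monom 1 1 :: int poly"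
  \<comment> \<open>X times the derivative of X^n - 1 is n X^n, which is \<open>n\<close> modulo
    \<open>f\<close>; the product rule leaves X f' g.\<close>
  have "?X * pderiv (monom 1 n - 1) = of_nat n * monom 1 n"
    using n(1) by (simp add: pderiv_diff pderiv_monom mult_monom of_nat_poly smult_monom)
  moreover have "monom 1 n = 1 + f * g" using g by (simp add: algebra_simps)
  ultimately have "?X * (f * pderiv g + g * pderiv f) = of_nat n * (1 + f * g)"
    unfolding g by (simp add: pderiv_mult)
  then have "of_nat n - ?X * pderiv f * g = f * (?X * pderiv g - of_nat n * g)"
    by (simp add: algebra_simps)
  then have 1: "f dvd of_nat n - ?X * pderiv f * g" by simp
  have "of_nat n - ?X * pderiv f * g dvd of_nat n ^ p - (?X * pderiv f * g) ^ p"
    by (subst power_diff_sumr2) simp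
  with 1 have 2: "f dvd of_nat n ^ p - (?X * pderiv f * g) ^ p" by (rule dvd_trans)
  \<comment> \<open>Modulo \<open>f\<close> the polynomial g(X^p) vanishes, so g^p becomes p
    k.\<close>
  have "of_nat n ^ p - of_nat p * (k * (?X * pderiv f) ^ p)
      = (of_nat n ^ p - (?X * pderiv f * g) ^ p) + f * (u * (?X * pderiv f) ^ p)"
  proof -
    have "g ^ p = of_nat p * k + f * u" using k u by (simp add: algebra_simps)
    then show ?thesis unfolding power_mult_distrib[of "?X * pderiv f" g] by (simp add: algebra_simps)
  qed
  then have "f dvd of_nat n ^ p - of_nat p * (k * (?X * pderiv f) ^ p)"
    using 2 by (metis dvd_add dvd_triv_left)
  then have "f dvd [:int n ^ p:] - [:int p:] * (k * (?X * pderiv f) ^ p)"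
    by (simp add: of_nat_poly poly_const_pow)
  then have "int p dvd int n ^ p" by (rule const_dvd_mult_mod_monic[OF lf df])
  then have "p dvd n ^ p" by (simp flip: of_nat_power)
  then show False using p prime_dvd_power by blast
qed

text \<open>Prime factors of \<open>j\<close> do not divide \<open>n\<close> and are stripped one at
  a time; every intermediate power is again an n-th root of unity.\<close>

lemma root_coprime_power:
  assumes f: "prime_elem f" and n: "n > 0"
  shows "poly (cpoly f) z = 0 \<Longrightarrow> z ^ n = 1 \<Longrightarrow> coprime j n \<Longrightarrow> j > 0 \<Longrightarrow> poly (cpoly f) (z ^ j) = 0"
proof (induction j rule: less_induct)
  case (less j)
  show ?case
  proof (cases "j = 1")
    case False
    then obtain p where p: "prime p" "p dvd j" using prime_factor_nat by blast
    then obtain i where i: "j = p * i" by blast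
    have "i > 0" "i < j" using less.prems(4) i prime_gt_1_nat[OF p(1)] by auto
    have "coprime i n" "coprime p n" using less.prems(3) i by auto
    have "poly (cpoly f) (z ^ i) = 0" by (rule less.IH) fact+
    moreover have "(z ^ i) ^ n = (z ^ n) ^ i" by (simp add: mult.commute flip: power_mult)
    then have "(z ^ i) ^ n = 1" using less.prems(2) by simp
    moreover have "\<not> p dvd n" using \<open>coprime p n\<close> p(1) coprime_common_divisor[of p n p] by auto
    ultimately have "poly (cpoly f) ((z ^ i) ^ p) = 0" using root_prime_power[OF f _ n _ p(1)] by blast
    then show ?thesis unfolding i by (simp add: power_mult mult.commute[of p i])
  qed (use less.prems in simp)
qed

text \<open>All primitive n-th roots of unity are powers of \<open>z\<close> with exponent coprime
  to \<open>n\<close>, hence roots of \<open>f\<close>; conversely \<open>f\<close> shares the root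
  \<open>z\<close> with \<Phi>_n. So the two divide each other.\<close>

lemma prime_eq_cyclotomic:
  assumes f: "prime_elem f" "poly (cpoly f) z = 0" and n: "n > 0" "z \<in> primitive_roots_of_unity n"
  shows "f = cyclotomic n \<or> f = - cyclotomic n"
proof -
  have "cyclotomic n dvd f"
  proof (rule cyclotomic_dvdI[OF n(1)])
    fix w assume "w \<in> primitive_roots_of_unity n"
    then obtain j where "j > 0" "coprime j n" "w = z ^ j" using primitive_root_is_power n by blast
    then show "poly (cpoly f) w = 0"
      using root_coprime_power[OF f(1) n(1) f(2)] n(2) by (auto simp: primitive_roots_of_unity_def)
  qed
  moreover have "f dvd cyclotomic n"
    using n by (intro prime_dvd_if_common_root[OF f]) (simp add: poly_cyclotomic_eq_0_iff)
  ultimately obtain u v where u: "f = cyclotomic n * u" "cyclotomic n = f * v" unfolding dvd_def by blast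
  have "cyclotomic n \<noteq> 0" using lead_coeff_cyclotomic[OF n(1)] by force
  then have "u * v = 1" using u by (metis mult.assoc mult.right_neutral mult_left_cancel)
  then have "is_unit u" by (metis dvd_triv_left)
  then obtain c where "u = [:c:]" "is_unit c" by (rule is_unit_polyE)
  then show ?thesis using u(1) by (auto simp: abs_if split: if_splits)
qed

section \<open>Classification of generic units\<close>

lemma defines_generic_units_iff_product:
  "defines_generic_units f \<longleftrightarrow>
    (\<exists>(m::nat) (k::nat) (ms :: nat \<Rightarrow> nat).
      (\<forall>i\<in>{1..k}. ms i > 0 \<and> ms i \<noteq> 1 \<and> \<not> primepow (ms i)) \<and>
      (f = monom 1 m * (\<Prod>i=1..k. cyclotomic (ms i)) \<or>
       f = - (monom 1 m * (\<Prod>i=1..k. cyclotomic (ms i)))))"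
  (is "_ \<longleftrightarrow> (\<exists>m k ms. ?P k ms \<and> ?E f m k ms)")
proof
  assume "\<exists>m k ms. ?P k ms \<and> ?E f m k ms"
  then obtain m k ms where P: "?P k ms" and E: "?E f m k ms" by blast
  define D where "D = (\<Prod>i=1..k. ms i)"
  have "D > 0" unfolding D_def using P by (intro prod_pos) auto
  moreover have "defines_unit_on f n" if n: "n > 0" "coprime n D" for n
  proof -
    have "defines_unit_on (cyclotomic (ms i)) n" if i: "i \<in> {1..k}" for i
    proof (rule defines_unit_on_cyclotomic)
      show "coprime n (ms i)"
        using n(2) i coprime_divisors[of n n "ms i" D] dvd_prodI[of "{1..k}" i ms] by (simp add: D_def)
      show "is_unit (poly (cyclotomic (ms i)) 1)"
        using P[rule_format, OF i] by (intro cyclotomic_at_1) linarith+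
    qed (use P i n in auto)
    then have "defines_unit_on (\<Prod>i=1..k. cyclotomic (ms i)) n"
      by (intro defines_unit_on_prod) (use n(1) in auto)
    then have "defines_unit_on (monom 1 m * (\<Prod>i=1..k. cyclotomic (ms i))) n"
      using n(1) by (simp add: defines_unit_on_mult_iff defines_unit_on_monom)
    then show ?thesis using E n(1) by (auto simp: defines_unit_on_uminus)
  qed
  ultimately show "defines_generic_units f" by (auto simp: defines_generic_units_def)
next
  assume "defines_generic_units f"
  then show "\<exists>m k ms. ?P k ms \<and> ?E f m k ms"
  \<comment> \<open>Factors of generic units are generic, so each prime factor can be identified
    separately.\<close>
  proof (induction f rule: prime_divisors_induct)
    case zero
    then show ?case using defines_generic_units_poly_1[of 0] by simp
  next
    case (unit f)
    then obtain c where "f = [:c:]" "is_unit c" by (metis is_unit_polyE)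
    then have "?E f 0 0 (\<lambda>_. 0)" by (auto simp: abs_if monom_0 one_pCons split: if_splits)
    then show ?case by (intro exI[of _ 0] exI[of _ "\<lambda>_. 0"]) simp
  next
    case (factor p f)
    have p: "prime_elem p" "defines_generic_units p" and f: "defines_generic_units f"
      using prime_imp_prime_elem[OF factor.hyps] defines_generic_units_mult[OF factor.prems] by blast+
    obtain m k ms where P: "?P k ms" and E: "?E f m k ms" using factor.IH[OF f] by blast
    have p1: "is_unit (poly p 1)" by (rule defines_generic_units_poly_1[OF p(2)])
    show ?case
    proof (cases "poly p 0 = 0")
      case True
      then have X: "[:0, 1:] dvd p" by (simp add: poly_eq_0_iff_dvd)
      then obtain q where q: "p = [:0, 1:] * q" by blast
      \<comment> \<open>The polynomials p and X share the root 0 and divide each other, so p =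
        \<plusminus>X and only the exponent \<open>m\<close> grows.\<close>
      have "p dvd [:0, 1:]"
        using poly_cpoly_eq_0[OF X, of 0] by (intro prime_dvd_if_common_root[OF p(1)]) (simp_all add: map_poly_pCons)
      then obtain r where "[:0, 1:] = p * r" by blast
      then have "[:0, 1:] = [:0, 1 :: int:] * (q * r)" unfolding q by (simp only: mult.assoc)
      then have "q * r = 1" by (simp add: one_pCons)
      then obtain c where "q = [:c:]" "is_unit c" by (metis dvd_triv_left is_unit_polyE)
      then have "p = monom 1 1 \<or> p = - monom 1 1"
        unfolding q by (auto simp: abs_if monom_altdef split: if_splits)
      then have "?E (p * f) (Suc m) k ms"
        using E by (auto simp: mult_monom simp flip: mult.assoc)
      then show ?thesis using P by blast
    next
      case False
      \<comment> \<open>A constant prime would equal the unit p(1).\<close>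
      have dp: "degree p > 0"
      proof (rule ccontr)
        assume "\<not> degree p > 0"
        then obtain c where "p = [:c:]" by (metis degree_eq_zeroE gr0I)
        then show False using p1 p(1) by (auto simp: is_unit_const_poly_iff prime_elem_def)
      qed
      then obtain z where z: "poly (cpoly p) z = 0" using ex_cpoly_root by blast
      obtain n where n: "n > 0" "z \<in> primitive_roots_of_unity n"
        using prime_generic_root_of_unity[OF p dp False z] ex_primitive_root_of_unity by blast
      have pc: "p = cyclotomic n \<or> p = - cyclotomic n" by (rule prime_eq_cyclotomic[OF p(1) z n])
      then have u: "is_unit (poly (cyclotomic n) 1)" using p1 by auto
      have "n \<noteq> 1"
      proof
        assume "n = 1"
        then have "cyclotomic n = monom 1 1 - 1" using prod_cyclotomic[of 1] by simp
        then show False using u by (simp add: poly_monom)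
      qed
      moreover have "\<not> primepow n" using u cyclotomic_primepow_at_1 by blast
      ultimately have "?P (Suc k) (ms(Suc k := n))" using P n(1) by (auto simp: le_Suc_eq)
      moreover have "(\<Prod>i=1..Suc k. cyclotomic ((ms(Suc k := n)) i)) = (\<Prod>i=1..k. cyclotomic (ms i)) * cyclotomic n"
        by simp
      then have "?E (p * f) m (Suc k) (ms(Suc k := n))" using E pc by (auto simp: ac_simps)
      ultimately show ?thesis by blast
    qed
  qed
qed

theorem theorem0p1:
  fixes f :: "int poly"
  shows "(defines_generic_units f \<longleftrightarrow>
           (\<exists>b r :: nat. b > 0 \<and> r > 0 \<and> (\<forall>n \<in> {b + j * r | j::nat. j \<ge> 0}. defines_unit_on f n)))
       \<and> (defines_generic_units f \<longleftrightarrow>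
           (\<exists>D::nat. D > 0 \<and> (\<forall>n>0. \<exists>m. n \<le> m \<and> m \<le> n + D \<and> defines_unit_on f m)))
       \<and> (defines_generic_units f \<longleftrightarrow>
           (\<exists>(m::nat) (k::nat) (ms :: nat \<Rightarrow> nat).
              (\<forall>i\<in>{1..k}. ms i > 0 \<and> ms i \<noteq> 1 \<and> \<not> primepow (ms i)) \<and>
              (f = monom 1 m * (\<Prod>i=1..k. cyclotomic (ms i)) \<or>
               f = - (monom 1 m * (\<Prod>i=1..k. cyclotomic (ms i))))))"
proof -
  let ?S2 = "\<exists>b r :: nat. b > 0 \<and> r > 0 \<and> (\<forall>n \<in> {b + j * r | j::nat. j \<ge> 0}. defines_unit_on f n)"
  let ?S3 = "\<exists>D::nat. D > 0 \<and> (\<forall>n>0. \<exists>m. n \<le> m \<and> m \<le> n + D \<and> defines_unit_on f m)"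
  have "?S2" if "defines_generic_units f"
  proof -
    obtain D where D: "D > 0" "\<forall>n>0. coprime n D \<longrightarrow> defines_unit_on f n"
      using \<open>defines_generic_units f\<close> by (auto simp: defines_generic_units_def)
    have "coprime (1 + j * D) D" for j
      by (rule coprimeI) (metis add.commute dvd_add_right_iff dvd_mult)
    then have "\<forall>n \<in> {1 + j * D | j::nat. j \<ge> 0}. defines_unit_on f n" using D(2) by auto
    then show ?thesis using D(1) zero_less_one by blast
  qed
  moreover have "?S3" if "?S2"
  proof -
    obtain b r where br: "b > 0" "r > 0" "\<forall>n \<in> {b + j * r | j::nat. j \<ge> 0}. defines_unit_on f n"
      using \<open>?S2\<close> by blast
    have "\<exists>m. n \<le> m \<and> m \<le> n + (b + r) \<and> defines_unit_on f m" for n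
    proof (intro exI conjI)
      \<comment> \<open>The next multiple of \<open>r\<close> exceeds \<open>n\<close> by at most
        \<open>r\<close>, and the offset adds \<open>b\<close>.\<close>
      let ?m = "b + Suc (n div r) * r"
      have "n div r * r + n mod r = n" by simp
      moreover have "n mod r < r" using br(2) by simp
      ultimately show "n \<le> ?m" "?m \<le> n + (b + r)" unfolding mult_Suc by linarith+
      show "defines_unit_on f ?m" using br(3) by blast
    qed
    then show ?thesis using br(1) by (intro exI[of _ "b + r"]) simp
  qed
  moreover have "defines_generic_units f" if "?S3"
    using that defines_generic_units_if_bounded_gaps by blast
  ultimately have "defines_generic_units f \<longleftrightarrow> ?S2" "defines_generic_units f \<longleftrightarrow> ?S3" by blast+
  then show ?thesis using defines_generic_units_iff_product[of f] by (intro conjI)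
qed

end
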